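(* Let $0<\alpha'_i<\alpha''_i$ be such that $m_i^{-1}(\alpha''_i)<R_i$ for $1\le i\le K$ (that is, $\alpha''_i=m_i(\theta)$ for some $0<\theta<R_i$). Let $\boldsymbol{s}=(s_1,\dots,s_K)$ be a fixed vector of non-negative integers with $b_{is_i}>0$ for $1\le i\le K$. For positive integers $N$ and $\boldsymbol{n}=(n_1,\dots,n_K)$ let $\mu_{\boldsymbol{s}\boldsymbol{n}N}$ be the number of boxes containing exactly $s_i$ balls of colour $i$ for every $1\le i\le K$ in the multi-colour generalized allocation scheme of placing $n_i$ balls of colour $i$ ($1\le i\le K$) into $N$ boxes. Put $\alpha_i=n_i/N$, $\theta_{i\alpha_i}=m_i^{-1}(\alpha_i)$, $$p_{\boldsymbol{s}\boldsymbol{n}N}=\prod_{i=1}^K\frac{b_{is_i}\theta_{i\alpha_i}^{s_i}}{s_i!\,B_i(\theta_{i\alpha_i})},\qquad \sigma^2_{\boldsymbol{s}\boldsymbol{n}N}=p_{\boldsymbol{s}\boldsymbol{n}N}(1-p_{\boldsymbol{s}\boldsymbol{n}N}),\qquad \sigma_{\boldsymbol{s}\boldsymbol{n}N}=\sqrt{\sigma^2_{\boldsymbol{s}\boldsymbol{n}N}}.$$ Then $$\limsup_{\substack{\boldsymbol{n}\to\infty,\;N\to\infty,\\ \alpha'_i<\alpha_i<\alpha''_i,\;1\le i\le K}}\frac{|\mu_{\boldsymbol{s}\boldsymbol{n}N}-\mathbb{E}\mu_{\boldsymbol{s}\boldsymbol{n}N}|}{\sqrt{N\ln(N)}\,\sigma_{\boldsymbol{s}\boldsymbol{n}N}}\le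 4\sqrt{1+\frac{3K}{2}}\quad\text{almost surely.}$$
   Context: $K\ge1$ is a fixed integer (the number of colours). For each $1\le i\le K$, $(b_{ik})_{k\ge0}$ is a sequence of non-negative real numbers with $b_{i0}>0$, $b_{i1}>0$, such that the power series $B_i(\theta)=\sum_{k=0}^\infty \frac{b_{ik}\theta^k}{k!}$ has positive (possibly infinite) radius of convergence $R_i$. For $0<\theta<R_i$, $\xi_i(\theta)$ denotes a random variable with $\mathbb{P}\{\xi_i(\theta)=k\}=\frac{b_{ik}\theta^k}{k!B_i(\theta)}$, $k=0,1,2,\dots$, and $m_i(\theta)=\mathbb{E}\,\xi_i(\theta)=\theta B_i'(\theta)/B_i(\theta)$. The function $m_i$ is continuous and strictly increasing on $(0,R_i)$, and $m_i^{-1}$ is its inverse. Multi-colour generalized allocation scheme: for $N$ boxes and $n_i$ balls of colour $i$ ($1\le i\le K$), it is a family of random vectors $\boldsymbol{\eta}_j=(\eta_{1j},\dots,\eta_{Kj})$, $1\le j\le N$, with non-negative integer coordinates ($\eta_{ij}$ is the number of balls of colour $i$ in box $j$) whose joint distribution is $$\mathbb{P}\{\boldsymbol{\eta}_1=\boldsymbol{k}_1,\dots,\boldsymbol{\eta}_N=\boldsymbol{k}_N\}=\prod_{i=1}^K\mathbb{P}\{\xi_{i1}=k_{i1},\dots,\xi_{iN}=k_{iN}\mid \xi_{i1}+\dots+\xi_{iN}=n_i\}$$ for all non-negative integer vectors $\boldsymbol{k}_j=(k_{1j},\dots,k_{Kj})$ with $k_{i1}+\dots+k_{iN}=n_i$,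 $1\le i\le K$. Here all $\xi_{ij}$ are independent and, for each $i$, $\xi_{i1},\dots,\xi_{iN}$ are independent copies of $\xi_i(\theta_i)$ for some $\theta_i\in(0,R_i)$ (the conditional distribution does not depend on the choice of $\theta_i$). The number of boxes with contents exactly $\boldsymbol{s}=(s_1,\dots,s_K)$ is $\mu_{\boldsymbol{s}\boldsymbol{n}N}=\sum_{j=1}^{N}\prod_{i=1}^K\mathbb{I}_{\{\eta_{ij}=s_i\}}$, where $\mathbb{I}$ denotes the indicator. For different $(\boldsymbol{n},N)$ the allocation schemes are defined on one common probability space; nothing is assumed about their joint distribution. The scheme is considered for parameters for which the conditioning events have positive probability (this holds for all sufficiently large $N$ in the sector $\alpha'_i<n_i/N<\alpha''_i$, $1\le i\le K$). The limsup over the sector is the multi-index one: $\lim_{M\to\infty}$ of the supremum over all $(\boldsymbol{n},N)$ with $N\ge M$, $n_i\ge M$ and $\alpha'_i<n_i/N<\alpha''_i$ for all $1\le i\le K$. *)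

theory Defs
  imports "HOL-Probability.Probability"
begin

definition B_series :: "(nat \<Rightarrow> real) \<Rightarrow> real \<Rightarrow> real" where
  "B_series b \<theta> = (\<Sum>k. b k * \<theta> ^ k / fact k)"

definition B_radius :: "(nat \<Rightarrow> real) \<Rightarrow> ereal" where
  "B_radius b = conv_radius (\<lambda>k. b k / fact k)"

definition param_range :: "(nat \<Rightarrow> real) \<Rightarrow> real set" where
  "param_range b = {\<theta>. 0 < \<theta> \<and> ereal \<theta> < B_radius b}"

text \<open>The law of \<open>\<xi>(\<theta>)\<close>; lemma \<open>pmf_xi_law\<close> below shows that the given
  weights do form a probability mass function for \<open>\<theta>\<close> in the admissible range.\<close>

definition xi_law :: "(nat \<Rightarrow> real) \<Rightarrow> real \<Rightarrow> nat pmf" where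
  "xi_law b \<theta> = embed_pmf (\<lambda>k. b k * \<theta> ^ k / (fact k * B_series b \<theta>))"

lemma pmf_xi_law:
  assumes nonneg: "\<And>k. 0 \<le> b k" and b0: "0 < b 0" and \<theta>: "\<theta> \<in> param_range b"
  shows "pmf (xi_law b \<theta>) k = b k * \<theta> ^ k / (fact k * B_series b \<theta>)"
proof -
  have \<theta>0: "0 < \<theta>" and "ereal (norm \<theta>) < conv_radius (\<lambda>k. b k / fact k)"
    using \<theta> by (auto simp: param_range_def B_radius_def)
  then have summ: "summable (\<lambda>k. b k * \<theta> ^ k / fact k)"
    using summable_in_conv_radius[of \<theta> "\<lambda>k. b k / fact k"] by simp
  have term0: "0 \<le> b k * \<theta> ^ k / fact k" for k
    using nonneg[of k] \<theta>0 by simp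
  have "0 < B_series b \<theta>"
    unfolding B_series_def using suminf_pos2[OF summ term0, of 0] b0 by simp
  note Bpos = this
  have sums: "(\<lambda>k. b k * \<theta> ^ k / (fact k * B_series b \<theta>)) sums 1"
    using sums_divide[OF summable_sums[OF summ], of "B_series b \<theta>"] Bpos
    by (simp add: B_series_def)
  have ge: "0 \<le> b k * \<theta> ^ k / (fact k * B_series b \<theta>)" for k
    using nonneg[of k] \<theta>0 Bpos by simp
  have "(\<integral>\<^sup>+ k. ennreal (b k * \<theta> ^ k / (fact k * B_series b \<theta>)) \<partial>count_space UNIV) = 1"
    using suminf_ennreal_eq[OF ge sums] by (simp add: nn_integral_count_space_nat)
  then show ?thesis
    unfolding xi_law_def by (intro pmf_embed_pmf ge)
qed

definition xi_mean :: "(nat \<Rightarrow> real) \<Rightarrow> real \<Rightarrow> real" where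
  "xi_mean b \<theta> = measure_pmf.expectation (xi_law b \<theta>) real"

definition xi_mean_inv :: "(nat \<Rightarrow> real) \<Rightarrow> real \<Rightarrow> real" where
  "xi_mean_inv b = inv_into (param_range b) (xi_mean b)"

text \<open>The joint law of independent copies \<open>\<xi>\<^sub>1, \<dots>, \<xi>\<^sub>N\<close> of \<open>\<xi>(\<theta>)\<close>.\<close>

definition xi_copies :: "(nat \<Rightarrow> real) \<Rightarrow> real \<Rightarrow> nat \<Rightarrow> (nat \<Rightarrow> nat) pmf" where
  "xi_copies b \<theta> N = Pi_pmf {1..N} 0 (\<lambda>_. xi_law b \<theta>)"

text \<open>Colours are the elements of a finite type \<open>'c\<close>, so \<open>K = CARD('c)\<close>; boxes are
  \<open>1, \<dots>, N\<close>. The event below is the conditioning event of the allocation scheme.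
  Whether it has positive probability does not depend on the parameters \<open>\<theta>\<close>.\<close>

definition admissible :: "('c::finite \<Rightarrow> nat \<Rightarrow> real) \<Rightarrow> ('c \<Rightarrow> nat) \<Rightarrow> nat \<Rightarrow> bool" where
  "admissible b n N \<longleftrightarrow>
     (\<forall>i. \<exists>\<theta>\<in>param_range (b i).
        0 < measure_pmf.prob (xi_copies (b i) \<theta> N) {x. (\<Sum>j=1..N. x j) = n i})"

text \<open>\<open>\<eta> j \<omega> i\<close> is the number of balls of colour \<open>i\<close> in box \<open>j\<close>.\<close>

definition allocation_scheme ::
  "'a measure \<Rightarrow> ('c::finite \<Rightarrow> nat \<Rightarrow> real) \<Rightarrow> ('c \<Rightarrow> nat) \<Rightarrow> nat
    \<Rightarrow> (nat \<Rightarrow> 'a \<Rightarrow> 'c \<Rightarrow> nat) \<Rightarrow> bool" where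
  "allocation_scheme M b n N \<eta> \<longleftrightarrow>
     (\<forall>j\<in>{1..N}. \<eta> j \<in> measurable M (count_space UNIV)) \<and>
     (\<exists>\<theta>. (\<forall>i. \<theta> i \<in> param_range (b i)) \<and>
       (\<forall>k :: nat \<Rightarrow> 'c \<Rightarrow> nat. (\<forall>i. (\<Sum>j=1..N. k j i) = n i) \<longrightarrow>
          measure M {\<omega> \<in> space M. \<forall>j\<in>{1..N}. \<eta> j \<omega> = k j} =
          (\<Prod>i\<in>UNIV. cond_prob (measure_pmf (xi_copies (b i) (\<theta> i) N))
             (\<lambda>x. \<forall>j\<in>{1..N}. x j = k j i) (\<lambda>x. (\<Sum>j=1..N. x j) = n i))))"

definition box_count ::
  "(nat \<Rightarrow> 'a \<Rightarrow> 'c::finite \<Rightarrow> nat) \<Rightarrow> ('c \<Rightarrow> nat) \<Rightarrow> nat \<Rightarrow> 'a \<Rightarrow> real" where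
  "box_count \<eta> s N \<omega> = (\<Sum>j=1..N. \<Prod>i\<in>UNIV. indicator {\<omega>'. \<eta> j \<omega>' i = s i} \<omega>)"

definition p_box ::
  "('c::finite \<Rightarrow> nat \<Rightarrow> real) \<Rightarrow> ('c \<Rightarrow> nat) \<Rightarrow> ('c \<Rightarrow> nat) \<Rightarrow> nat \<Rightarrow> real" where
  "p_box b s n N =
     (\<Prod>i\<in>UNIV. let \<theta> = xi_mean_inv (b i) (real (n i) / real N)
        in b i (s i) * \<theta> ^ s i / (fact (s i) * B_series (b i) \<theta>))"

definition sigma_box ::
  "('c::finite \<Rightarrow> nat \<Rightarrow> real) \<Rightarrow> ('c \<Rightarrow> nat) \<Rightarrow> ('c \<Rightarrow> nat) \<Rightarrow> nat \<Rightarrow> real" where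
  "sigma_box b s n N = sqrt (p_box b s n N * (1 - p_box b s n N))"

definition sector ::
  "('c::finite \<Rightarrow> real) \<Rightarrow> ('c \<Rightarrow> real) \<Rightarrow> nat \<Rightarrow> (('c \<Rightarrow> nat) \<times> nat) set" where
  "sector \<alpha>' \<alpha>'' m = {(n, N). m \<le> N \<and>
     (\<forall>i. m \<le> n i \<and> \<alpha>' i < real (n i) / real N \<and> real (n i) / real N < \<alpha>'' i)}"

definition sector_at_top ::
  "('c::finite \<Rightarrow> real) \<Rightarrow> ('c \<Rightarrow> real) \<Rightarrow> (('c \<Rightarrow> nat) \<times> nat) filter" where
  "sector_at_top \<alpha>' \<alpha>'' = (INF m. principal (sector \<alpha>' \<alpha>'' m))"

lemma eventually_sector_at_top:
  "eventually P (sector_at_top \<alpha>' \<alpha>'') \<longleftrightarrow> (\<exists>m. \<forall>x\<in>sector \<alpha>' \<alpha>'' m. P x)"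
  unfolding sector_at_top_def
proof (subst eventually_INF_base, goal_cases)
  case (2 a b)
  show ?case by (rule bexI[of _ "max a b"]) (auto simp: sector_def)
qed (auto simp: eventually_principal)

text \<open>The limit superior along this filter is the multi-index one.\<close>

lemma Limsup_sector_at_top:
  fixes f :: "('c::finite \<Rightarrow> nat) \<times> nat \<Rightarrow> ereal"
  shows "(\<lambda>m. SUP x\<in>sector \<alpha>' \<alpha>'' m. f x) \<longlonglongrightarrow> Limsup (sector_at_top \<alpha>' \<alpha>'') f"
proof -
  have "decseq (\<lambda>m. SUP x\<in>sector \<alpha>' \<alpha>'' m. f x)"
    unfolding decseq_def sector_def by (intro allI impI SUP_subset_mono) (auto intro: order_trans)
  then have "(\<lambda>m. SUP x\<in>sector \<alpha>' \<alpha>'' m. f x) \<longlonglongrightarrow> (INF m. SUP x\<in>sector \<alpha>' \<alpha>'' m. f x)"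
    by (rule LIMSEQ_INF)
  also have "(INF m. SUP x\<in>sector \<alpha>' \<alpha>'' m. f x) = Limsup (sector_at_top \<alpha>' \<alpha>'') f"
    unfolding Limsup_def
  proof (rule antisym)
    show "(INF m. SUP x\<in>sector \<alpha>' \<alpha>'' m. f x)
        \<le> (INF P\<in>{P. eventually P (sector_at_top \<alpha>' \<alpha>'')}. SUP x\<in>{x. P x}. f x)"
    proof (rule INF_greatest)
      fix P assume "P \<in> {P. eventually P (sector_at_top \<alpha>' \<alpha>'')}"
      then obtain m where "\<forall>x\<in>sector \<alpha>' \<alpha>'' m. P x"
        by (auto simp: eventually_sector_at_top)
      then show "(INF m. SUP x\<in>sector \<alpha>' \<alpha>'' m. f x) \<le> (SUP x\<in>{x. P x}. f x)"
        by (intro INF_lower2[of m] SUP_subset_mono) auto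
    qed
    show "(INF P\<in>{P. eventually P (sector_at_top \<alpha>' \<alpha>'')}. SUP x\<in>{x. P x}. f x)
        \<le> (INF m. SUP x\<in>sector \<alpha>' \<alpha>'' m. f x)"
    proof (rule INF_greatest)
      fix m
      show "(INF P\<in>{P. eventually P (sector_at_top \<alpha>' \<alpha>'')}. SUP x\<in>{x. P x}. f x)
          \<le> (SUP x\<in>sector \<alpha>' \<alpha>'' m. f x)"
        by (rule INF_lower2[of "\<lambda>x. x \<in> sector \<alpha>' \<alpha>'' m"])
          (auto simp: eventually_sector_at_top)
    qed
  qed
  finally show ?thesis .
qed

end

theory Submission
  imports Defs "HOL-Real_Asymp.Real_Asymp"
begin

text \<open>Write \<open>K\<close> for the number of colours. Without conditioning, the boxes would be independent and
the number \<open>\<mu>\<close> of boxes with contents \<open>s\<close> would be binomial with parameters \<open>N\<close> and \<open>p\<close>. The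
allocation scheme is this independent model conditioned on the event that the colour totals
are \<open>n\<close>, and conditioning on an event of probability \<open>z\<close> multiplies the probability of any other
event by at most \<open>1 / z\<close>. If the parameters \<open>\<theta>\<^sub>i\<close> are chosen so that the expected totals are
exactly \<open>n\<close>, then \<open>z\<close> is only polynomially small, whereas deviations of \<open>\<mu>\<close> of order
\<open>sqrt (N ln N)\<close> have a polynomially small probability whose exponent can be made larger.

\<^item> Tail of the independent model: by the exponential moment method, a deviation of
\<open>\<kappa> \<sigma> sqrt (N ln N)\<close> has probability at most \<open>2 N powr - c\<close>, where \<open>c\<close> is any number below \<open>\<kappa>\<^sup>2 / 2\<close> and \<open>N\<close> is large
(\<open>count_tail\<close>, \<open>deviation_exponent\<close>). With \<open>\<kappa>\<close> slightly below \<open>2 sqrt (1 + 3 K / 2)\<close> the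
exponent can be taken as \<open>2 K + 2\<close>.

\<^item> Cost of conditioning: each colour total equals its mean \<open>n\<^sub>i\<close> with probability at least
\<open>1 / N\<close> (\<open>local_lower_bound\<close>), hence \<open>z \<ge> N powr - K\<close>. The bound is weaker than the true order
\<open>N powr - 1/2\<close> but has an elementary proof: some total within \<open>O(sqrt N)\<close> of \<open>n\<^sub>i\<close> is
attained with probability of order at least \<open>N powr - 1/2\<close>, and turning an empty box into a box with one
ball shows that the probabilities of neighbouring totals are nearly equal.

\<^item> In the conditioned scheme the deviation thus has probability at most \<open>2 N powr - (K + 2)\<close>.
There are \<open>O(N powr K)\<close> vectors \<open>n\<close> in the sector for each \<open>N\<close>, so the Borel--Cantelli lemma
applies and \<open>\<bar>\<mu> - N p\<bar> < \<kappa> \<sigma> sqrt (N ln N)\<close> eventually, almost surely.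

\<^item> The same tail estimate gives \<open>\<bar>E \<mu> - N p\<bar> \<le> \<kappa> \<sigma> sqrt (N ln N) + O(1)\<close>. Centring at the
expectation instead of \<open>N p\<close> therefore doubles the constant, to \<open>4 sqrt (1 + 3 K / 2)\<close>; the
\<open>O(1)\<close> is absorbed by the small reduction of \<open>\<kappa>\<close>, because \<open>\<sigma>\<close> is bounded away from zero on the
sector.

The uniformity over the sector comes from \<open>mean_inverse_in_compact\<close>: all parameters \<open>\<theta>\<^sub>i\<close> that
occur lie in a compact subinterval of the range of convergence.\<close>

section \<open>The one-colour law and its mean\<close>

lemma has_bochner_integral_nat_pmf:
  fixes p :: "nat pmf" and f :: "nat \<Rightarrow> real"
  assumes f: "\<And>k. 0 \<le> f k" and S: "(\<lambda>k. pmf p k * f k) sums S"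
  shows "has_bochner_integral (measure_pmf p) f S"
proof (rule has_bochner_integral_nn_integral)
  have "(\<integral>\<^sup>+ k. ennreal (f k) \<partial>measure_pmf p)
      = (\<integral>\<^sup>+ k. ennreal (pmf p k * f k) \<partial>count_space UNIV)"
    by (simp add: nn_integral_measure_pmf ennreal_mult' f)
  also have "\<dots> = ennreal S"
    unfolding nn_integral_count_space_nat by (rule suminf_ennreal_eq) (use f S in auto)
  finally show "(\<integral>\<^sup>+ k. ennreal (f k) \<partial>measure_pmf p) = ennreal S" .
  show "0 \<le> S"
    using sums_le[OF _ sums_zero S] f by simp
qed (use f in auto)

locale weight_sequence =
  fixes b :: "nat \<Rightarrow> real"
  assumes nonneg: "0 \<le> b k" and pos0: "0 < b 0" and pos1: "0 < b 1"
begin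

lemma summable_B:
  assumes "\<theta> \<in> param_range b"
  shows "summable (\<lambda>k. b k * \<theta> ^ k / fact k)"
  using summable_in_conv_radius[of \<theta> "\<lambda>k. b k / fact k"] assms
  by (simp add: param_range_def B_radius_def)

lemma param_range_downward:
  assumes "\<phi> \<in> param_range b" "0 < \<theta>" "\<theta> \<le> \<phi>"
  shows "\<theta> \<in> param_range b"
  using assms unfolding param_range_def
  by (metis (mono_tags, lifting) ereal_less_eq(3) mem_Collect_eq order_le_less_trans)

lemma param_range_enlarge:
  assumes "\<phi> \<in> param_range b"
  obtains \<psi> where "\<psi> \<in> param_range b" "\<phi> < \<psi>"
proof -
  have "ereal \<phi> < B_radius b" "0 < \<phi>" using assms by (auto simp: param_range_def)
  then obtain \<psi> where "ereal \<phi> < ereal \<psi>" "ereal \<psi> < B_radius b"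
    using ereal_dense2 by blast
  then show ?thesis using that[of \<psi>] \<open>0 < \<phi>\<close> by (auto simp: param_range_def)
qed

lemma b0_le_B:
  assumes "\<theta> \<in> param_range b"
  shows "b 0 \<le> B_series b \<theta>"
proof -
  have "0 < \<theta>" using assms by (simp add: param_range_def)
  then have "(\<Sum>k<1. b k * \<theta> ^ k / fact k) \<le> B_series b \<theta>"
    unfolding B_series_def by (intro sum_le_suminf summable_B assms) (auto simp: nonneg)
  then show ?thesis by simp
qed

lemma B_pos: "\<theta> \<in> param_range b \<Longrightarrow> 0 < B_series b \<theta>"
  using b0_le_B pos0 by fastforce

lemma B_mono:
  assumes "\<phi> \<in> param_range b" "0 < \<theta>" "\<theta> \<le> \<phi>"
  shows "B_series b \<theta> \<le> B_series b \<phi>"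
  unfolding B_series_def using assms
  by (intro suminf_le summable_B param_range_downward[OF assms])
     (auto intro!: divide_right_mono mult_left_mono power_mono simp: nonneg)

lemma pmf_xi:
  "\<theta> \<in> param_range b \<Longrightarrow> pmf (xi_law b \<theta>) k = b k * \<theta> ^ k / (fact k * B_series b \<theta>)"
  by (rule pmf_xi_law) (auto simp: nonneg pos0)

text \<open>Multiplying the weights by \<open>c ^ k\<close> is the same as replacing \<open>\<theta>\<close> by \<open>c * \<theta>\<close>; exponential
moments are therefore quotients of values of the generating series.\<close>

lemma power_moment:
  assumes \<theta>: "\<theta> \<in> param_range b" and c: "c * \<theta> \<in> param_range b"
  shows "has_bochner_integral (xi_law b \<theta>) (\<lambda>k. c ^ k) (B_series b (c * \<theta>) / B_series b \<theta>)"
proof (rule has_bochner_integral_nat_pmf)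
  have "0 < c" using \<theta> c by (auto simp: param_range_def zero_less_mult_iff)
  then show "0 \<le> c ^ k" for k by simp
  have "(\<lambda>k. b k * (c * \<theta>) ^ k / fact k / B_series b \<theta>) sums
      (B_series b (c * \<theta>) / B_series b \<theta>)"
    unfolding B_series_def by (intro sums_divide summable_sums summable_B c)
  then show "(\<lambda>k. pmf (xi_law b \<theta>) k * c ^ k) sums (B_series b (c * \<theta>) / B_series b \<theta>)"
    by (simp add: pmf_xi[OF \<theta>] power_mult_distrib mult_ac)
qed

definition B_deriv :: "real \<Rightarrow> real" where
  "B_deriv \<theta> = (\<Sum>k. diffs (\<lambda>k. b k / fact k) k * \<theta> ^ k)"

lemma summable_B_deriv:
  assumes "\<theta> \<in> param_range b"
  shows "summable (\<lambda>k. diffs (\<lambda>k. b k / fact k) k * \<theta> ^ k)"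
proof -
  obtain \<psi> where \<psi>: "\<psi> \<in> param_range b" "\<theta> < \<psi>" by (rule param_range_enlarge[OF assms])
  have "0 < \<theta>" "0 < \<psi>" using assms \<psi> by (auto simp: param_range_def)
  show ?thesis
  proof (rule termdiff_converges[of \<theta> \<psi>])
    fix x :: real assume "norm x < \<psi>"
    then have "ereal (norm x) < B_radius b"
      using \<psi> by (auto simp: param_range_def intro: ereal_less_le less_trans)
    then show "summable (\<lambda>k. b k / fact k * x ^ k)"
      unfolding B_radius_def by (rule summable_in_conv_radius)
  qed (use \<psi> \<open>0 < \<theta>\<close> in auto)
qed

lemma mean_integral:
  assumes \<theta>: "\<theta> \<in> param_range b"
  shows "has_bochner_integral (xi_law b \<theta>) real (\<theta> * B_deriv \<theta> / B_series b \<theta>)"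
proof (rule has_bochner_integral_nat_pmf)
  have "(\<lambda>k. \<theta> * (diffs (\<lambda>k. b k / fact k) k * \<theta> ^ k) / B_series b \<theta>)
      sums (\<theta> * B_deriv \<theta> / B_series b \<theta>)"
    unfolding B_deriv_def by (intro sums_divide sums_mult summable_sums summable_B_deriv \<theta>)
  also have "(\<lambda>k. \<theta> * (diffs (\<lambda>k. b k / fact k) k * \<theta> ^ k) / B_series b \<theta>)
      = (\<lambda>k. pmf (xi_law b \<theta>) (Suc k) * real (Suc k))"
    by (simp add: diffs_def pmf_xi[OF \<theta>] fun_eq_iff mult_ac)
  finally show "(\<lambda>k. pmf (xi_law b \<theta>) k * real k) sums (\<theta> * B_deriv \<theta> / B_series b \<theta>)"
    by (subst (asm) sums_Suc_iff) simp
qed simp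

lemma mean_eq:
  "\<theta> \<in> param_range b \<Longrightarrow> xi_mean b \<theta> = \<theta> * B_deriv \<theta> / B_series b \<theta>"
  unfolding xi_mean_def using mean_integral by (simp add: has_bochner_integral_iff)

lemma mean_integrable: "\<theta> \<in> param_range b \<Longrightarrow> integrable (xi_law b \<theta>) real"
  using mean_integral by (simp add: has_bochner_integral_iff)

lemma isCont_mean_formula:
  assumes "\<theta> \<in> param_range b"
  shows "isCont (\<lambda>\<theta>. \<theta> * B_deriv \<theta> / B_series b \<theta>) \<theta>"
proof -
  obtain \<psi> where \<psi>: "\<psi> \<in> param_range b" "\<theta> < \<psi>" by (rule param_range_enlarge[OF assms])
  have pos: "0 < \<theta>" "0 < \<psi>" using assms \<psi> by (auto simp: param_range_def)
  have "isCont (\<lambda>x. \<Sum>k. (b k / fact k) * x ^ k) \<theta>"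
    by (rule isCont_powser[of _ \<psi>]) (use summable_B[OF \<psi>(1)] \<psi> pos in auto)
  then have "isCont (B_series b) \<theta>"
    by (simp add: B_series_def[abs_def])
  moreover have "isCont B_deriv \<theta>"
    unfolding B_deriv_def[abs_def]
    by (rule isCont_powser[of _ \<psi>]) (use summable_B_deriv[OF \<psi>(1)] \<psi> pos in auto)
  ultimately show ?thesis
    using B_pos[OF assms] by (intro continuous_intros) auto
qed

text \<open>This is Jensen's inequality for the convex function \<open>k \<mapsto> c powr k\<close> under the law with parameter
\<open>\<theta>\<close>, where \<open>c = \<phi> / \<theta>\<close>: the expectation of \<open>c ^ k\<close> is the right-hand side, and the proof
integrates the tangent line of the function at the mean.\<close>

lemma tilting_inequality:
  assumes \<theta>: "\<theta> \<in> param_range b" and \<phi>: "\<phi> \<in> param_range b"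
  shows "(\<phi> / \<theta>) powr xi_mean b \<theta> \<le> B_series b \<phi> / B_series b \<theta>"
proof -
  define c where "c = \<phi> / \<theta>"
  define m where "m = xi_mean b \<theta>"
  have "0 < \<theta>" "0 < \<phi>" using assms by (auto simp: param_range_def)
  then have c: "0 < c" "c * \<theta> = \<phi>" by (auto simp: c_def)
  note pm = power_moment[OF \<theta>, of c, unfolded c(2), OF \<phi>, unfolded has_bochner_integral_iff]
  have lin: "c powr m * (1 + (real k - m) * ln c) \<le> c ^ k" for k
  proof -
    have "c powr m * (1 + (real k - m) * ln c) \<le> c powr m * exp ((real k - m) * ln c)"
      by (intro mult_left_mono exp_ge_add_one_self) auto
    also have "\<dots> = c ^ k"
      using c by (simp add: powr_def exp_add[symmetric] algebra_simps flip: powr_realpow)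
    finally show ?thesis .
  qed
  note int = mean_integrable[OF \<theta>]
  have "c powr m = (\<integral>k. c powr m * (1 + (real k - m) * ln c) \<partial>xi_law b \<theta>)"
    using int by (simp add: m_def xi_mean_def)
  also have "\<dots> \<le> (\<integral>k. c ^ k \<partial>xi_law b \<theta>)"
    using int pm lin by (intro integral_mono) auto
  finally show ?thesis using pm by (simp add: c_def m_def)
qed

text \<open>The tilting inequality used from \<open>\<theta>\<close> to \<open>\<phi>\<close> and from \<open>\<phi>\<close> to \<open>\<theta>\<close> places the quotient of the two
values of the series between \<open>(\<phi> / \<theta>) powr xi_mean b \<theta>\<close> and
\<open>(\<phi> / \<theta>) powr xi_mean b \<phi>\<close>.\<close>

lemma mean_mono:
  assumes \<phi>: "\<phi> \<in> param_range b" and "0 < \<theta>" "\<theta> < \<phi>"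
  shows "xi_mean b \<theta> \<le> xi_mean b \<phi>"
proof -
  have \<theta>: "\<theta> \<in> param_range b" using param_range_downward[OF \<phi>] assms by auto
  have "(\<phi> / \<theta>) powr xi_mean b \<theta> \<le> B_series b \<phi> / B_series b \<theta>"
    by (rule tilting_inequality[OF \<theta> \<phi>])
  also have "\<dots> = inverse (B_series b \<theta> / B_series b \<phi>)" by simp
  also have "\<dots> \<le> inverse ((\<theta> / \<phi>) powr xi_mean b \<phi>)"
    using tilting_inequality[OF \<phi> \<theta>] assms by (intro le_imp_inverse_le) auto
  also have "\<dots> = (\<phi> / \<theta>) powr xi_mean b \<phi>"
    using assms by (simp add: powr_minus[symmetric] powr_divide divide_simps)
  finally show ?thesis
    using assms by (subst (asm) powr_le_cancel_iff) (auto simp: field_simps)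
qed

lemma mean_nonneg: "0 \<le> xi_mean b \<theta>"
  unfolding xi_mean_def by simp

text \<open>Since the mean vanishes linearly at zero, a positive lower bound on the mean forces a positive
lower bound on the parameter.\<close>

lemma mean_small:
  assumes \<phi>: "\<phi> \<in> param_range b" and "0 < \<theta>" "\<theta> \<le> \<phi>"
  shows "xi_mean b \<theta> \<le> \<theta> * (B_deriv \<phi> / b 0)"
proof -
  have \<theta>: "\<theta> \<in> param_range b" using param_range_downward[OF \<phi>] assms by auto
  have d: "0 \<le> diffs (\<lambda>k. b k / fact k) k" for k by (simp add: diffs_def nonneg)
  have "B_deriv \<theta> \<le> B_deriv \<phi>"
    unfolding B_deriv_def using assms d
    by (intro suminf_le summable_B_deriv \<theta> \<phi> mult_left_mono power_mono) auto
  moreover have "0 \<le> B_deriv \<theta>"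
    unfolding B_deriv_def using assms d by (intro suminf_nonneg summable_B_deriv \<theta>) auto
  ultimately have "\<theta> * B_deriv \<theta> / B_series b \<theta> \<le> \<theta> * B_deriv \<phi> / b 0"
    using assms pos0 b0_le_B[OF \<theta>] by (intro frac_le) auto
  then show ?thesis by (simp add: mean_eq[OF \<theta>])
qed

lemma B_deriv_pos:
  assumes "\<theta> \<in> param_range b"
  shows "0 < B_deriv \<theta>"
  unfolding B_deriv_def
proof (rule suminf_pos2[where i = 0])
  have "0 < \<theta>" using assms by (simp add: param_range_def)
  then show "0 \<le> diffs (\<lambda>k. b k / fact k) k * \<theta> ^ k" for k by (simp add: diffs_def nonneg)
qed (use summable_B_deriv[OF assms] pos1 in \<open>auto simp: diffs_def\<close>)

text \<open>The intermediate value theorem shows that every mean between the bounds is attained, so that the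
choice made by \<^const>\<open>xi_mean_inv\<close> is a genuine preimage; monotonicity of the mean then
confines every preimage to one compact interval.\<close>

lemma mean_inverse_in_compact:
  assumes "0 < \<alpha>'" "\<alpha>'' \<in> xi_mean b ` param_range b"
  obtains \<theta>\<^sub>1 \<theta>\<^sub>2 where "0 < \<theta>\<^sub>1" "\<theta>\<^sub>2 \<in> param_range b"
    "\<And>\<alpha>. \<alpha>' < \<alpha> \<Longrightarrow> \<alpha> < \<alpha>'' \<Longrightarrow> xi_mean b (xi_mean_inv b \<alpha>) = \<alpha>
       \<and> \<theta>\<^sub>1 \<le> xi_mean_inv b \<alpha> \<and> xi_mean_inv b \<alpha> \<le> \<theta>\<^sub>2"
proof -
  obtain \<theta>\<^sub>2 where \<theta>\<^sub>2: "\<theta>\<^sub>2 \<in> param_range b" "\<alpha>'' = xi_mean b \<theta>\<^sub>2" using assms(2) by auto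
  then have pos2: "0 < \<theta>\<^sub>2" by (simp add: param_range_def)
  define D where "D = B_deriv \<theta>\<^sub>2 / b 0"
  have D: "0 < D" using B_deriv_pos[OF \<theta>\<^sub>2(1)] pos0 by (simp add: D_def)
  define \<theta>\<^sub>1 where "\<theta>\<^sub>1 = min \<theta>\<^sub>2 (\<alpha>' / D)"
  have \<theta>\<^sub>1: "0 < \<theta>\<^sub>1" "\<theta>\<^sub>1 \<le> \<theta>\<^sub>2" using assms D pos2 by (auto simp: \<theta>\<^sub>1_def)
  have m1: "xi_mean b \<theta>\<^sub>1 \<le> \<alpha>'"
  proof -
    have "xi_mean b \<theta>\<^sub>1 \<le> \<theta>\<^sub>1 * D" unfolding D_def by (rule mean_small[OF \<theta>\<^sub>2(1) \<theta>\<^sub>1])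
    also have "\<dots> \<le> (\<alpha>' / D) * D" using D by (intro mult_right_mono) (auto simp: \<theta>\<^sub>1_def)
    finally show ?thesis using D by simp
  qed
  have "xi_mean b (xi_mean_inv b \<alpha>) = \<alpha> \<and> \<theta>\<^sub>1 \<le> xi_mean_inv b \<alpha> \<and> xi_mean_inv b \<alpha> \<le> \<theta>\<^sub>2"
    if \<alpha>: "\<alpha>' < \<alpha>" "\<alpha> < \<alpha>''" for \<alpha>
  proof -
    have rng: "x \<in> param_range b" if "\<theta>\<^sub>1 \<le> x" "x \<le> \<theta>\<^sub>2" for x
      using param_range_downward[OF \<theta>\<^sub>2(1)] that \<theta>\<^sub>1 by auto
    have "\<exists>x\<ge>\<theta>\<^sub>1. x \<le> \<theta>\<^sub>2 \<and> x * B_deriv x / B_series b x = \<alpha>"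
    proof (rule IVT)
      show "\<theta>\<^sub>1 * B_deriv \<theta>\<^sub>1 / B_series b \<theta>\<^sub>1 \<le> \<alpha>"
        using m1 \<alpha> mean_eq[OF rng[of \<theta>\<^sub>1]] \<theta>\<^sub>1 by simp
      show "\<alpha> \<le> \<theta>\<^sub>2 * B_deriv \<theta>\<^sub>2 / B_series b \<theta>\<^sub>2"
        using \<theta>\<^sub>2 \<alpha> mean_eq[OF \<theta>\<^sub>2(1)] by simp
    qed (use \<theta>\<^sub>1 isCont_mean_formula rng in auto)
    then have im: "\<alpha> \<in> xi_mean b ` param_range b"
      using mean_eq rng by (metis image_eqI)
    define x where "x = xi_mean_inv b \<alpha>"
    have x: "x \<in> param_range b" "xi_mean b x = \<alpha>"
      unfolding x_def xi_mean_inv_def using im by (auto intro: inv_into_into f_inv_into_f)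
    then have "0 < x" by (simp add: param_range_def)
    have "\<not> x < \<theta>\<^sub>1"
      using mean_mono[of \<theta>\<^sub>1 x] rng[of \<theta>\<^sub>1] \<theta>\<^sub>1 \<open>0 < x\<close> x m1 \<alpha> by auto
    moreover have "\<not> \<theta>\<^sub>2 < x"
      using mean_mono[of x \<theta>\<^sub>2] x pos2 \<alpha> \<theta>\<^sub>2 by auto
    ultimately show ?thesis using x by (simp add: x_def)
  qed
  then show ?thesis using that[of \<theta>\<^sub>1 \<theta>\<^sub>2] \<theta>\<^sub>1 \<theta>\<^sub>2 by blast
qed

end

section \<open>Tails of sums of independent copies\<close>

lemma exp_le_quadratic:
  fixes y :: real
  shows "exp y \<le> 1 + y + y\<^sup>2 / 2 * exp \<bar>y\<bar>"
proof -
  obtain t where t: "\<bar>t\<bar> \<le> \<bar>y\<bar>" "exp y = (\<Sum>m<2. y ^ m / fact m) + exp t / fact 2 * y ^ 2"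
    using Maclaurin_exp_le by blast
  then have "exp t * y\<^sup>2 \<le> exp \<bar>y\<bar> * y\<^sup>2" by (intro mult_right_mono) auto
  then show ?thesis using t(2) by (simp add: numeral_2_eq_2 algebra_simps)
qed

text \<open>For a centred variable the linear term of the exponential integrates to zero. The weight
\<open>exp (l * \<bar>f x\<bar>)\<close> in the second moment keeps the bound sharp to first order as \<open>l\<close> tends to zero:
then \<open>V\<close> may approach the variance, which decides the constant of the theorem.\<close>

lemma mgf_centred_bound:
  fixes p :: "'x pmf" and f :: "'x \<Rightarrow> real"
  assumes f: "integrable p f" and mean: "measure_pmf.expectation p f = 0"
    and h: "integrable p (\<lambda>x. (f x)\<^sup>2 * exp (l * \<bar>f x\<bar>))"
    and V: "measure_pmf.expectation p (\<lambda>x. (f x)\<^sup>2 * exp (l * \<bar>f x\<bar>)) \<le> V"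
    and l: "0 \<le> l"
  shows "integrable p (\<lambda>x. exp (l * f x))"
    and "measure_pmf.expectation p (\<lambda>x. exp (l * f x)) \<le> exp (l\<^sup>2 * V / 2)"
proof -
  let ?g = "\<lambda>x. 1 + l * f x + l\<^sup>2 / 2 * ((f x)\<^sup>2 * exp (l * \<bar>f x\<bar>))"
  have g: "integrable p ?g" using f h by simp
  have le: "exp (l * f x) \<le> ?g x" for x
    using exp_le_quadratic[of "l * f x"] l by (simp add: abs_mult power_mult_distrib)
  show int: "integrable p (\<lambda>x. exp (l * f x))"
    by (rule Bochner_Integration.integrable_bound[OF g])
       (use le in \<open>auto intro: order_trans[OF _ abs_ge_self]\<close>)
  have "measure_pmf.expectation p (\<lambda>x. exp (l * f x)) \<le> measure_pmf.expectation p ?g"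
    by (intro integral_mono int g le)
  also have "\<dots> \<le> 1 + l\<^sup>2 * V / 2"
    using f h mean mult_left_mono[OF V, of "l\<^sup>2 / 2"] by simp
  also have "\<dots> \<le> exp (l\<^sup>2 * V / 2)" by (rule exp_ge_add_one_self)
  finally show "measure_pmf.expectation p (\<lambda>x. exp (l * f x)) \<le> exp (l\<^sup>2 * V / 2)" .
qed

lemma iid_upper_tail:
  fixes p :: "'x pmf" and f :: "'x \<Rightarrow> real" and A :: "'j set"
  assumes A: "finite A" and f: "integrable p f" and mean: "measure_pmf.expectation p f = 0"
    and h: "integrable p (\<lambda>x. (f x)\<^sup>2 * exp (l * \<bar>f x\<bar>))"
    and V: "measure_pmf.expectation p (\<lambda>x. (f x)\<^sup>2 * exp (l * \<bar>f x\<bar>)) \<le> V"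
    and l: "0 < l"
  shows "measure_pmf.prob (Pi_pmf A d (\<lambda>_. p)) {x. t \<le> (\<Sum>j\<in>A. f (x j))}
           \<le> exp (- l * t + real (card A) * (l\<^sup>2 * V / 2))"
proof -
  let ?P = "Pi_pmf A d (\<lambda>_. p)"
  note mgf = mgf_centred_bound[OF f mean h V less_imp_le[OF l]]
  have eq: "exp (l * (\<Sum>j\<in>A. f (x j))) = (\<Prod>j\<in>A. exp (l * f (x j)))" for x
    using A by (simp add: sum_distrib_left exp_sum)
  have int: "integrable ?P (\<lambda>x. exp (l * (\<Sum>j\<in>A. f (x j))))"
    unfolding eq by (intro integrable_prod_Pi_pmf A mgf(1))
  have E: "measure_pmf.expectation ?P (\<lambda>x. exp (l * (\<Sum>j\<in>A. f (x j))))
      = measure_pmf.expectation p (\<lambda>x. exp (l * f x)) ^ card A"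
    unfolding eq by (subst expectation_prod_Pi_pmf[OF A mgf(1)]) auto
  have "measure_pmf.prob ?P {x. t \<le> (\<Sum>j\<in>A. f (x j))}
      \<le> exp (- l * t) * measure_pmf.expectation ?P (\<lambda>x. exp (l * (\<Sum>j\<in>A. f (x j))))"
    using measure_pmf.Chernoff_ineq_ge[OF l, of ?P UNIV "\<lambda>x. \<Sum>j\<in>A. f (x j)" t] int
    by (simp add: set_integrable_def set_lebesgue_integral_def)
  also have "\<dots> \<le> exp (- l * t) * exp (l\<^sup>2 * V / 2) ^ card A"
    unfolding E by (intro mult_left_mono power_mono mgf(2) integral_nonneg) auto
  also have "\<dots> = exp (- l * t + real (card A) * (l\<^sup>2 * V / 2))"
    by (simp only: exp_add exp_of_nat_mult)
  finally show ?thesis .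
qed

lemma iid_two_sided_tail:
  fixes p :: "'x pmf" and f :: "'x \<Rightarrow> real" and A :: "'j set"
  assumes A: "finite A" and f: "integrable p f" and mean: "measure_pmf.expectation p f = 0"
    and h: "integrable p (\<lambda>x. (f x)\<^sup>2 * exp (l * \<bar>f x\<bar>))"
    and V: "measure_pmf.expectation p (\<lambda>x. (f x)\<^sup>2 * exp (l * \<bar>f x\<bar>)) \<le> V"
    and l: "0 < l"
  shows "measure_pmf.prob (Pi_pmf A d (\<lambda>_. p)) {x. t \<le> \<bar>\<Sum>j\<in>A. f (x j)\<bar>}
           \<le> 2 * exp (- l * t + real (card A) * (l\<^sup>2 * V / 2))"
proof -
  let ?P = "Pi_pmf A d (\<lambda>_. p)"
  have "measure_pmf.prob ?P {x. t \<le> \<bar>\<Sum>j\<in>A. f (x j)\<bar>}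
      \<le> measure_pmf.prob ?P ({x. t \<le> (\<Sum>j\<in>A. f (x j))} \<union> {x. t \<le> (\<Sum>j\<in>A. - f (x j))})"
    by (intro measure_pmf.finite_measure_mono) (auto simp: abs_if sum_negf)
  also have "\<dots> \<le> measure_pmf.prob ?P {x. t \<le> (\<Sum>j\<in>A. f (x j))}
                + measure_pmf.prob ?P {x. t \<le> (\<Sum>j\<in>A. - f (x j))}"
    by (rule measure_Un_le) auto
  also have "measure_pmf.prob ?P {x. t \<le> (\<Sum>j\<in>A. - f (x j))}
      \<le> exp (- l * t + real (card A) * (l\<^sup>2 * V / 2))"
    by (rule iid_upper_tail[where f = "\<lambda>x. - f x"]) (use assms in auto)
  also have "measure_pmf.prob ?P {x. t \<le> (\<Sum>j\<in>A. f (x j))}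
      \<le> exp (- l * t + real (card A) * (l\<^sup>2 * V / 2))"
    by (rule iid_upper_tail[OF assms])
  finally show ?thesis by simp
qed

text \<open>The bounded summands \<open>of_bool (x = a) - pmf p a\<close> permit \<open>V = pmf p a * (1 - pmf p a) * exp l\<close>,
the Bernoulli variance up to a factor that tends to one with \<open>l\<close>.\<close>

lemma count_tail:
  fixes p :: "'x pmf" and A :: "'j set"
  assumes A: "finite A" and l: "0 < l"
  shows "measure_pmf.prob (Pi_pmf A d (\<lambda>_. p))
             {x. t \<le> \<bar>(\<Sum>j\<in>A. of_bool (x j = a)) - real (card A) * pmf p a\<bar>}
           \<le> 2 * exp (- l * t + real (card A) * (l\<^sup>2 * (pmf p a * (1 - pmf p a) * exp l) / 2))"
proof -
  define f where "f x = of_bool (x = a) - pmf p a" for x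
  have bnd: "\<bar>f x\<bar> \<le> 1" for x using pmf_le_1[of p a] by (simp add: f_def)
  have eq: "of_bool (x = a) = indicat_real {a} x" for x by (simp add: indicator_def)
  have int: "integrable p (\<lambda>x. of_bool (x = a) :: real)"
    unfolding eq by (auto intro!: measure_pmf.integrable_const_bound[where B = 1])
  have E: "measure_pmf.expectation p (\<lambda>x. of_bool (x = a)) = pmf p a"
    unfolding eq by (simp add: measure_pmf_single)
  have f: "integrable p f" "measure_pmf.expectation p f = 0"
    unfolding f_def[abs_def] using int E by simp_all
  have sq: "(f x)\<^sup>2 = (1 - 2 * pmf p a) * of_bool (x = a) + (pmf p a)\<^sup>2" for x
    by (simp add: f_def power2_eq_square algebra_simps)
  have fsq: "integrable p (\<lambda>x. (f x)\<^sup>2)" unfolding sq using int by simp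
  have Esq: "measure_pmf.expectation p (\<lambda>x. (f x)\<^sup>2) = pmf p a * (1 - pmf p a)"
    unfolding sq using int E by (simp add: power2_eq_square algebra_simps)
  have le: "(f x)\<^sup>2 * exp (l * \<bar>f x\<bar>) \<le> (f x)\<^sup>2 * exp l" for x
    using bnd[of x] l by (intro mult_left_mono) auto
  have h: "integrable p (\<lambda>x. (f x)\<^sup>2 * exp (l * \<bar>f x\<bar>))"
    by (rule Bochner_Integration.integrable_bound[of _ "\<lambda>x. (f x)\<^sup>2 * exp l"])
       (use fsq le in auto)
  have V: "measure_pmf.expectation p (\<lambda>x. (f x)\<^sup>2 * exp (l * \<bar>f x\<bar>))
      \<le> pmf p a * (1 - pmf p a) * exp l"
  proof -
    have "measure_pmf.expectation p (\<lambda>x. (f x)\<^sup>2 * exp (l * \<bar>f x\<bar>))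
        \<le> measure_pmf.expectation p (\<lambda>x. (f x)\<^sup>2 * exp l)"
      by (intro integral_mono h le) (use fsq in auto)
    then show ?thesis by (simp add: Esq)
  qed
  have "(\<Sum>j\<in>A. f (x j)) = (\<Sum>j\<in>A. of_bool (x j = a)) - real (card A) * pmf p a" for x :: "'j \<Rightarrow> 'x"
    unfolding f_def by (simp add: sum_subtractf)
  then show ?thesis
    using iid_two_sided_tail[OF A f h V l, of d t] by simp
qed

section \<open>Neighbouring values of a sum of independent copies\<close>

lemma prob_pair_pmf_Times:
  "measure_pmf.prob (pair_pmf p q) (A \<times> B) = measure_pmf.prob p A * measure_pmf.prob q B"
proof -
  have "measure_pmf.prob (pair_pmf p q) (A \<times> B)
      = measure_pmf.prob (pair_pmf p q) ((A \<inter> set_pmf p) \<times> (B \<inter> set_pmf q))"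
    by (subst measure_Int_set_pmf[symmetric]) (auto intro!: arg_cong[where f = "measure _"])
  also have "\<dots> = measure_pmf.prob p (A \<inter> set_pmf p) * measure_pmf.prob q (B \<inter> set_pmf q)"
    by (rule measure_pmf_prob_product) (auto intro: countable_Int2)
  finally show ?thesis by (simp add: measure_Int_set_pmf)
qed

text \<open>Prescribing one component leaves a condition on the sum of the others alone, and that condition
depends on the prescribed value \<open>a\<close> only through the shift of the total. Comparing \<open>a = 0\<close> and
\<open>a = 1\<close> links consecutive values of the sum.\<close>

lemma prob_component_and_sum:
  fixes p :: "nat pmf"
  assumes A: "finite A" "j \<in> A"
  shows "measure_pmf.prob (Pi_pmf A 0 (\<lambda>_. p)) {x. x j = a \<and> sum x A = a + k}
       = pmf p a * measure_pmf.prob (Pi_pmf (A - {j}) 0 (\<lambda>_. p)) {x. sum x (A - {j}) = k}"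
proof -
  define A' where "A' = A - {j}"
  have A': "A = insert j A'" "finite A'" "j \<notin> A'" using A by (auto simp: A'_def)
  have s: "sum (x(j := y)) A' = sum x A'" for x :: "'a \<Rightarrow> nat" and y
    using A' by (intro sum.cong) auto
  have "(\<lambda>(y, f). f(j := y)) -` {x. x j = a \<and> sum x A = a + k} = {a} \<times> {x. sum x A' = k}"
    unfolding A'(1) using A'(2,3) s by (auto simp: fun_upd_def)
  then have "measure_pmf.prob (Pi_pmf A 0 (\<lambda>_. p)) {x. x j = a \<and> sum x A = a + k}
      = measure_pmf.prob (pair_pmf p (Pi_pmf A' 0 (\<lambda>_. p))) ({a} \<times> {x. sum x A' = k})"
    by (simp add: A'(1) Pi_pmf_insert[OF A'(2,3)])
  then show ?thesis
    by (simp add: prob_pair_pmf_Times measure_pmf_single A'_def)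
qed

lemma count_times_sum_indicator:
  fixes p :: "nat pmf" and A :: "'j set"
  assumes A: "finite A"
  shows "measure_pmf.expectation (Pi_pmf A 0 (\<lambda>_. p))
           (\<lambda>x. (\<Sum>j\<in>A. of_bool (x j = a)) * of_bool (sum x A = a + k))
       = pmf p a * (\<Sum>j\<in>A. measure_pmf.prob (Pi_pmf (A - {j}) 0 (\<lambda>_. p)) {x. sum x (A - {j}) = k})"
proof -
  have "(\<Sum>j\<in>A. of_bool (x j = a)) * of_bool (sum x A = a + k)
      = (\<Sum>j\<in>A. indicat_real {x. x j = a \<and> sum x A = a + k} x)" for x :: "'j \<Rightarrow> nat"
    unfolding sum_distrib_right by (intro sum.cong) (auto simp: indicator_def)
  moreover have "integrable (Pi_pmf A 0 (\<lambda>_. p)) (indicat_real B)" for B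
    by (auto intro!: measure_pmf.integrable_const_bound[where B = 1])
  ultimately show ?thesis
    by (simp add: prob_component_and_sum[OF A] sum_distrib_left)
qed

text \<open>The number of components equal to \<open>a\<close> is close to its mean except on an event of probability at
most \<open>\<epsilon>\<close>. Its integral over the event that the sum is \<open>a + k\<close> is therefore close to that mean times
the probability of the event; on the other hand it is given exactly by
\<open>count_times_sum_indicator\<close>.\<close>

lemma sum_law_vs_removed_law:
  fixes p :: "nat pmf" and A :: "'j set"
  assumes A: "finite A"
    and tail: "measure_pmf.prob (Pi_pmf A 0 (\<lambda>_. p))
        {x. T \<le> \<bar>(\<Sum>j\<in>A. of_bool (x j = a)) - real (card A) * pmf p a\<bar>} \<le> \<epsilon>"
    and T: "0 \<le> T"
  shows "\<bar>pmf p a * (\<Sum>j\<in>A. measure_pmf.prob (Pi_pmf (A - {j}) 0 (\<lambda>_. p)) {x. sum x (A - {j}) = k})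
            - real (card A) * pmf p a * measure_pmf.prob (Pi_pmf A 0 (\<lambda>_. p)) {x. sum x A = a + k}\<bar>
       \<le> T * measure_pmf.prob (Pi_pmf A 0 (\<lambda>_. p)) {x. sum x A = a + k} + real (card A) * \<epsilon>"
proof -
  let ?P = "Pi_pmf A 0 (\<lambda>_. p)"
  define c where "c x = (\<Sum>j\<in>A. of_bool (x j = a) :: real)" for x :: "'j \<Rightarrow> nat"
  define S where "S = {x :: 'j \<Rightarrow> nat. sum x A = a + k}"
  define D where "D = {x :: 'j \<Rightarrow> nat. T \<le> \<bar>c x - real (card A) * pmf p a\<bar>}"
  have c: "0 \<le> c x" "c x \<le> card A" for x
    using sum_bounded_above[of A "\<lambda>j. of_bool (x j = a) :: real" 1] by (auto simp: c_def sum_nonneg)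
  have pa: "0 \<le> real (card A) * pmf p a" "real (card A) * pmf p a \<le> card A"
    using pmf_le_1[of p a] by (auto intro: mult_left_le)
  have dev: "\<bar>c x - real (card A) * pmf p a\<bar> \<le> card A" for x
    using c[of x] pa by linarith
  have int_ind: "integrable ?P (indicat_real B)" for B
    by (auto intro!: measure_pmf.integrable_const_bound[where B = 1])
  have int_c: "integrable ?P (\<lambda>x. c x * indicat_real S x)"
    using c by (intro measure_pmf.integrable_const_bound[where B = "card A"])
               (auto simp: indicator_def intro!: AE_pmfI)
  have "pmf p a * (\<Sum>j\<in>A. measure_pmf.prob (Pi_pmf (A - {j}) 0 (\<lambda>_. p)) {x. sum x (A - {j}) = k})
      = measure_pmf.expectation ?P (\<lambda>x. c x * indicat_real S x)"
    unfolding count_times_sum_indicator[OF A, symmetric]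
    by (intro Bochner_Integration.integral_cong) (auto simp: c_def S_def)
  then have "\<bar>pmf p a * (\<Sum>j\<in>A. measure_pmf.prob (Pi_pmf (A - {j}) 0 (\<lambda>_. p)) {x. sum x (A - {j}) = k})
            - real (card A) * pmf p a * measure_pmf.prob ?P S\<bar>
      = \<bar>measure_pmf.expectation ?P (\<lambda>x. c x * indicat_real S x
            - real (card A) * pmf p a * indicat_real S x)\<bar>"
    using int_c int_ind by simp
  also have "\<dots> \<le> measure_pmf.expectation ?P (\<lambda>x. \<bar>c x * indicat_real S x
            - real (card A) * pmf p a * indicat_real S x\<bar>)"
    by (rule integral_abs_bound)
  also have "\<dots> \<le> measure_pmf.expectation ?P (\<lambda>x. T * indicat_real S x + card A * indicat_real D x)"
  proof (intro integral_mono)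
    show "\<bar>c x * indicat_real S x - real (card A) * pmf p a * indicat_real S x\<bar>
        \<le> T * indicat_real S x + card A * indicat_real D x" for x
      using dev[of x] T by (cases "x \<in> S"; cases "x \<in> D") (auto simp: D_def)
  qed (use int_c int_ind in auto)
  also have "\<dots> = T * measure_pmf.prob ?P S + card A * measure_pmf.prob ?P D"
    using int_ind by simp
  also have "\<dots> \<le> T * measure_pmf.prob ?P S + card A * \<epsilon>"
    using tail by (intro add_left_mono mult_left_mono) (auto simp: D_def c_def)
  finally show ?thesis unfolding S_def .
qed

text \<open>For \<open>a = 0\<close> and \<open>a = 1\<close>, \<open>sum_law_vs_removed_law\<close> compares \<open>u k\<close> and \<open>u (k + 1)\<close> with the same quantity, the
average over \<open>j\<close> of the probability that the components other than \<open>j\<close> sum to \<open>k\<close>.\<close>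

lemma sum_law_step:
  fixes p :: "nat pmf" and A :: "'j set"
  defines "u \<equiv> \<lambda>k. measure_pmf.prob (Pi_pmf A 0 (\<lambda>_. p)) {x. sum x A = k}"
  assumes A: "finite A" "A \<noteq> {}"
    and \<delta>: "0 < \<delta>" "\<delta> \<le> pmf p 0" "\<delta> \<le> pmf p 1" and \<tau>: "0 < \<tau>" "\<tau> \<le> 1"
  shows "\<bar>u (Suc k) - u k\<bar> \<le> (\<tau> * (u k + u (Suc k)) + 4 * exp (- real (card A) * \<tau>\<^sup>2 / 2)) / \<delta>"
proof -
  define n where "n = real (card A)"
  define \<epsilon> where "\<epsilon> = 2 * exp (- n * \<tau>\<^sup>2 / 2)"
  define q where "q = (\<Sum>j\<in>A. measure_pmf.prob (Pi_pmf (A - {j}) 0 (\<lambda>_. p)) {x. sum x (A - {j}) = k}) / n"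
  have n: "0 < n" using A by (simp add: n_def card_gt_0_iff)
  have close: "\<bar>q - u (a + k)\<bar> \<le> (\<tau> * u (a + k) + \<epsilon>) / \<delta>" if a: "\<delta> \<le> pmf p a" for a
  proof -
    \<comment> \<open>The choice \<open>l = \<tau>\<close> in the tail bound works because \<open>exp \<tau> / 4 \<le> 3 / 4 < 1\<close>.\<close>
    have "pmf p a * (1 - pmf p a) \<le> 1 / 4"
      using zero_le_power2[of "pmf p a - 1 / 2"] by (simp add: power2_eq_square algebra_simps)
    moreover have "exp \<tau> \<le> 3" using exp_le \<tau> by (meson exp_le_cancel_iff order_trans)
    ultimately have V: "pmf p a * (1 - pmf p a) * exp \<tau> \<le> 1 / 4 * 3"
      using pmf_le_1[of p a] by (intro mult_mono) auto
    have "measure_pmf.prob (Pi_pmf A 0 (\<lambda>_. p))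
        {x. n * \<tau> \<le> \<bar>(\<Sum>j\<in>A. of_bool (x j = a)) - n * pmf p a\<bar>}
        \<le> 2 * exp (- \<tau> * (n * \<tau>) + n * (\<tau>\<^sup>2 * (pmf p a * (1 - pmf p a) * exp \<tau>) / 2))"
      unfolding n_def by (rule count_tail[OF A(1) \<tau>(1)])
    also have "\<dots> \<le> 2 * exp (- \<tau> * (n * \<tau>) + n * (\<tau>\<^sup>2 * 1 / 2))"
      using V n by (intro mult_left_mono iffD2[OF exp_le_cancel_iff] add_left_mono
          mult_left_mono divide_right_mono) auto
    also have "\<dots> = \<epsilon>" by (simp add: \<epsilon>_def power2_eq_square field_simps)
    finally have "\<bar>pmf p a * (q * n) - n * pmf p a * u (a + k)\<bar> \<le> n * \<tau> * u (a + k) + n * \<epsilon>"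
      using sum_law_vs_removed_law[OF A(1), where a = a and k = k and T = "n * \<tau>" and \<epsilon> = \<epsilon> and p = p] n \<tau>
      by (simp add: q_def u_def n_def)
    also have "pmf p a * (q * n) - n * pmf p a * u (a + k) = n * (pmf p a * (q - u (a + k)))"
      by (simp add: algebra_simps)
    also have "n * \<tau> * u (a + k) + n * \<epsilon> = n * (\<tau> * u (a + k) + \<epsilon>)"
      by (simp add: algebra_simps)
    finally have "pmf p a * \<bar>q - u (a + k)\<bar> \<le> \<tau> * u (a + k) + \<epsilon>"
      using n by (simp add: abs_mult)
    moreover have "\<delta> * \<bar>q - u (a + k)\<bar> \<le> pmf p a * \<bar>q - u (a + k)\<bar>"
      using a by (intro mult_right_mono) auto
    ultimately show ?thesis using \<delta> by (simp add: field_simps)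
  qed
  have "\<bar>u (Suc k) - u k\<bar> \<le> \<bar>q - u (0 + k)\<bar> + \<bar>q - u (1 + k)\<bar>" by simp
  also have "\<dots> \<le> (\<tau> * u (0 + k) + \<epsilon>) / \<delta> + (\<tau> * u (1 + k) + \<epsilon>) / \<delta>"
    using close[of 0] close[of 1] \<delta> by (intro add_mono) auto
  also have "\<dots> = (\<tau> * (u k + u (Suc k)) + 2 * \<epsilon>) / \<delta>"
    by (simp add: add_divide_distrib algebra_simps)
  finally show ?thesis by (simp add: \<epsilon>_def n_def)
qed

text \<open>A Harnack inequality with an additive error: when neighbouring values agree up to the relative
error \<open>r\<close>, each step loses at most the factor \<open>(1 - r) / (1 + r) \<ge> 1 - 2 * r\<close>, in either
direction.\<close>

lemma harnack_walk:
  fixes u :: "nat \<Rightarrow> real"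
  assumes step: "\<And>k. \<bar>u (Suc k) - u k\<bar> \<le> r * (u k + u (Suc k)) + e"
    and u: "\<And>k. 0 \<le> u k" and r: "0 \<le> r" "r \<le> 1 / 2" and e: "0 \<le> e"
    and d: "nat \<bar>int n - int k\<bar> \<le> L"
  shows "(1 - 2 * r) ^ L * u k - real L * e \<le> u n"
proof -
  define q where "q = 1 - 2 * r"
  have q: "0 \<le> q" "q \<le> 1" using r by (auto simp: q_def)
  have one: "q * x - e \<le> y" if "\<bar>y - x\<bar> \<le> r * (x + y) + e" "0 \<le> x" "0 \<le> y" for x y
  proof -
    have "(1 - r) * x - e \<le> (1 + r) * y" using that(1) by (auto simp: algebra_simps abs_le_iff)
    moreover have "(1 + r) * (q * x - e) \<le> (1 - r) * x - e"
    proof -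
      have "(1 + r) * q \<le> 1 - r" using r by (simp add: q_def algebra_simps)
      then have "(1 + r) * q * x \<le> (1 - r) * x" using that by (intro mult_right_mono) auto
      moreover have "0 \<le> r * e" using r e by simp
      ultimately show ?thesis by (simp add: algebra_simps)
    qed
    ultimately have "(1 + r) * (q * x - e) \<le> (1 + r) * y" by linarith
    then show ?thesis using r by (simp add: mult_le_cancel_left)
  qed
  have comb: "q ^ Suc D * x - real (Suc D) * e \<le> z"
    if "q ^ D * x - real D * e \<le> y" "q * y - e \<le> z" for D x y z
  proof -
    have "q * (q ^ D * x - real D * e) \<le> q * y" using that q by (intro mult_left_mono) auto
    moreover have "q * (real D * e) \<le> real D * e" using q e by (intro mult_left_le_one_le) auto
    ultimately show ?thesis using that by (simp add: algebra_simps)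
  qed
  have up: "q ^ D * u m - real D * e \<le> u (m + D)" for m D
  proof (induction D)
    case (Suc D)
    from comb[OF this one[of "u (m + Suc D)" "u (m + D)"]] show ?case
      using step[of "m + D"] u by simp
  qed simp
  have down: "q ^ D * u (m + D) - real D * e \<le> u m" for m D
  proof (induction D arbitrary: m)
    case (Suc D)
    from comb[OF Suc[of "Suc m"] one[of "u m" "u (Suc m)"]] show ?case
      using step[of m] u by (simp add: abs_minus_commute add.commute)
  qed simp
  define D where "D = nat \<bar>int n - int k\<bar>"
  have "q ^ D * u k - real D * e \<le> u n"
  proof (cases "k \<le> n")
    case True
    then have "n = k + D" by (simp add: D_def)
    then show ?thesis using up by simp
  next
    case False
    then have "k = n + D" by (simp add: D_def)
    then show ?thesis using down by simp
  qed
  moreover have "q ^ L * u k \<le> q ^ D * u k"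
    using q u d by (intro mult_right_mono power_decreasing) (auto simp: D_def)
  moreover have "real D * e \<le> real L * e"
    using e d by (intro mult_right_mono) (auto simp: D_def)
  ultimately show ?thesis unfolding q_def by linarith
qed

text \<open>The step error \<open>sqrt (8 * ln x / x)\<close> is as small as it can be while the additive errors stay of
order \<open>1 / x ^ 4\<close>. The loss over \<open>O(sqrt x)\<close> steps is then \<open>exp (- O(sqrt (ln x)))\<close>, smaller than
any power of \<open>x\<close>, so that a starting value of order \<open>x powr - 1/2\<close> stays above \<open>1 / x\<close>.\<close>

lemma walk_loss_negligible:
  fixes C c :: real
  assumes "0 < C" "0 < c"
  shows "\<forall>\<^sub>F x in at_top. 1 / x \<le>
     (1 - 2 * (C * sqrt (8 * ln x / x))) powr (c * sqrt x + 1) / (4 * (c * sqrt x + 1) + 2)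
       - (c * sqrt x + 1) * (4 * C / x ^ 4)"
  using assms by real_asymp

section \<open>A polynomial lower bound for the conditioning event\<close>

context weight_sequence
begin

text \<open>The square is dominated by a multiple of \<open>exp (l\<^sub>0 * \<bar>k - m\<bar>)\<close>, so the whole integrand is
dominated by a multiple of \<open>exp (2 * l\<^sub>0 * k)\<close>. With \<open>exp (2 * l\<^sub>0) = \<psi> / \<theta>\<^sub>2\<close> the integral of the
latter is the quotient of the generating series at \<open>\<theta> * \<psi> / \<theta>\<^sub>2 \<le> \<psi>\<close> and at \<open>\<theta>\<close>, hence bounded
uniformly in \<open>\<theta>\<close>.\<close>

lemma exponential_second_moment:
  assumes \<theta>\<^sub>2: "\<theta>\<^sub>2 \<in> param_range b"
  obtains l\<^sub>0 V where "0 < l\<^sub>0" "0 < V"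
    "\<And>\<theta> l. 0 < \<theta> \<Longrightarrow> \<theta> \<le> \<theta>\<^sub>2 \<Longrightarrow> 0 \<le> l \<Longrightarrow> l \<le> l\<^sub>0 \<Longrightarrow>
        integrable (xi_law b \<theta>) (\<lambda>k. (real k - xi_mean b \<theta>)\<^sup>2 * exp (l * \<bar>real k - xi_mean b \<theta>\<bar>))
      \<and> measure_pmf.expectation (xi_law b \<theta>)
          (\<lambda>k. (real k - xi_mean b \<theta>)\<^sup>2 * exp (l * \<bar>real k - xi_mean b \<theta>\<bar>)) \<le> V"
proof -
  obtain \<psi> where \<psi>: "\<psi> \<in> param_range b" "\<theta>\<^sub>2 < \<psi>" by (rule param_range_enlarge[OF \<theta>\<^sub>2])
  have pos: "0 < \<theta>\<^sub>2" using \<theta>\<^sub>2 by (simp add: param_range_def)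
  define c where "c = \<psi> / \<theta>\<^sub>2"
  have c: "1 < c" using \<psi> pos by (simp add: c_def)
  define l\<^sub>0 where "l\<^sub>0 = ln c / 2"
  have l\<^sub>0: "0 < l\<^sub>0" using c by (simp add: l\<^sub>0_def)
  define G where "G = 2 / l\<^sub>0\<^sup>2 * c powr xi_mean b \<theta>\<^sub>2"
  have G: "0 < G" using l\<^sub>0 c by (simp add: G_def)
  define V where "V = G * (B_series b \<psi> / b 0)"
  have "0 < V" using G B_pos[OF \<psi>(1)] pos0 by (simp add: V_def)
  moreover have "integrable (xi_law b \<theta>) (\<lambda>k. (real k - xi_mean b \<theta>)\<^sup>2 * exp (l * \<bar>real k - xi_mean b \<theta>\<bar>))
      \<and> measure_pmf.expectation (xi_law b \<theta>)
          (\<lambda>k. (real k - xi_mean b \<theta>)\<^sup>2 * exp (l * \<bar>real k - xi_mean b \<theta>\<bar>)) \<le> V"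
    if th: "0 < \<theta>" "\<theta> \<le> \<theta>\<^sub>2" and l: "0 \<le> l" "l \<le> l\<^sub>0" for \<theta> l
  proof -
    define m where "m = xi_mean b \<theta>"
    have \<theta>: "\<theta> \<in> param_range b" by (rule param_range_downward[OF \<theta>\<^sub>2 th])
    have m: "0 \<le> m" "m \<le> xi_mean b \<theta>\<^sub>2"
      using mean_mono[OF \<theta>\<^sub>2 th(1)] th mean_nonneg by (auto simp: m_def le_less)
    have c\<theta>: "0 < c * \<theta>" "c * \<theta> \<le> \<psi>"
    proof -
      show "0 < c * \<theta>" using c th by simp
      have "c * \<theta> \<le> c * \<theta>\<^sub>2" using c th by (intro mult_left_mono) auto
      then show "c * \<theta> \<le> \<psi>" using pos by (simp add: c_def)
    qed
    note c\<theta>r = param_range_downward[OF \<psi>(1) c\<theta>]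
    note pm = power_moment[OF \<theta> c\<theta>r, unfolded has_bochner_integral_iff]
    have le: "(real k - m)\<^sup>2 * exp (l * \<bar>real k - m\<bar>) \<le> G * c ^ k" for k
    proof -
      define y where "y = \<bar>real k - m\<bar>"
      have y: "0 \<le> y" "y \<le> real k + m" using m by (auto simp: y_def)
      have "(l\<^sub>0 * y)\<^sup>2 / 2 \<le> exp (l\<^sub>0 * y)"
        using exp_lower_Taylor_quadratic[of "l\<^sub>0 * y"] l\<^sub>0 y
        by (smt (verit, best) mult_nonneg_nonneg)
      then have "y\<^sup>2 \<le> 2 / l\<^sub>0\<^sup>2 * exp (l\<^sub>0 * y)"
        using l\<^sub>0 by (simp add: field_simps power_mult_distrib)
      moreover have "exp (l * y) \<le> exp (l\<^sub>0 * y)" using l y by (simp add: mult_right_mono)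
      ultimately have "y\<^sup>2 * exp (l * y) \<le> 2 / l\<^sub>0\<^sup>2 * exp (l\<^sub>0 * y) * exp (l\<^sub>0 * y)"
        using l\<^sub>0 by (intro mult_mono) auto
      also have "\<dots> = 2 / l\<^sub>0\<^sup>2 * c powr y"
        using c by (simp add: powr_def l\<^sub>0_def exp_add[symmetric] mult.commute)
      also have "\<dots> \<le> 2 / l\<^sub>0\<^sup>2 * c powr (real k + xi_mean b \<theta>\<^sub>2)"
        using c y m by (intro mult_left_mono powr_mono) auto
      also have "\<dots> = G * c ^ k" using c by (simp add: G_def powr_add powr_realpow)
      finally show ?thesis by (simp add: y_def)
    qed
    have int: "integrable (xi_law b \<theta>) (\<lambda>k. (real k - m)\<^sup>2 * exp (l * \<bar>real k - m\<bar>))"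
      by (rule Bochner_Integration.integrable_bound[of _ "\<lambda>k. G * c ^ k"])
         (use pm le in \<open>auto intro: order_trans[OF _ abs_ge_self]\<close>)
    have "measure_pmf.expectation (xi_law b \<theta>) (\<lambda>k. (real k - m)\<^sup>2 * exp (l * \<bar>real k - m\<bar>))
        \<le> measure_pmf.expectation (xi_law b \<theta>) (\<lambda>k. G * c ^ k)"
      using pm le by (intro integral_mono int) auto
    also have "\<dots> = G * (B_series b (c * \<theta>) / B_series b \<theta>)" using pm by simp
    also have "\<dots> \<le> V"
      unfolding V_def using G B_mono[OF \<psi>(1) c\<theta>] b0_le_B[OF \<theta>] pos0 B_pos[OF \<psi>(1)]
      by (intro mult_left_mono frac_le) auto
    finally show ?thesis using int by (simp add: m_def)
  qed
  ultimately show ?thesis using that[OF l\<^sub>0] by blast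
qed

lemma point_probabilities_bounded_below:
  assumes \<theta>\<^sub>2: "\<theta>\<^sub>2 \<in> param_range b" and "0 < \<theta>\<^sub>1" "0 < b k"
  obtains \<delta> where "0 < \<delta>"
    "\<And>\<theta>. \<theta>\<^sub>1 \<le> \<theta> \<Longrightarrow> \<theta> \<le> \<theta>\<^sub>2 \<Longrightarrow> \<delta> \<le> pmf (xi_law b \<theta>) k"
proof -
  define \<delta> where "\<delta> = b k * \<theta>\<^sub>1 ^ k / (fact k * B_series b \<theta>\<^sub>2)"
  have "0 < \<delta>" using assms B_pos[OF \<theta>\<^sub>2] by (simp add: \<delta>_def)
  moreover have "\<delta> \<le> pmf (xi_law b \<theta>) k" if th: "\<theta>\<^sub>1 \<le> \<theta>" "\<theta> \<le> \<theta>\<^sub>2" for \<theta>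
  proof -
    have \<theta>: "\<theta> \<in> param_range b" "0 < \<theta>" using param_range_downward[OF \<theta>\<^sub>2] th assms by auto
    show ?thesis
      unfolding pmf_xi[OF \<theta>(1)] \<delta>_def using th assms B_pos[OF \<theta>(1)] B_mono[OF \<theta>\<^sub>2 \<theta>(2) th(2)]
      by (intro frac_le mult_left_mono power_mono) auto
  qed
  ultimately show ?thesis using that by blast
qed

text \<open>At least half of the mass of the sum lies within \<open>O(sqrt N)\<close> of its mean \<open>n\<close>, so by the pigeonhole
principle one of these values carries mass of order at least \<open>N powr - 1/2\<close>. The tail bound is used with
\<open>l = 1 / sqrt N\<close>, where it plays the role of Chebyshev's inequality.\<close>

lemma sum_law_heavy_point:
  assumes \<theta>: "\<theta> \<in> param_range b" and N: "0 < N" "real N * xi_mean b \<theta> = real n"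
    and int: "integrable (xi_law b \<theta>) (\<lambda>k. (real k - xi_mean b \<theta>)\<^sup>2 * exp (\<bar>real k - xi_mean b \<theta>\<bar> / sqrt N))"
    and V: "measure_pmf.expectation (xi_law b \<theta>)
          (\<lambda>k. (real k - xi_mean b \<theta>)\<^sup>2 * exp (\<bar>real k - xi_mean b \<theta>\<bar> / sqrt N)) \<le> V"
    and L: "(V / 2 + 2) * sqrt N \<le> real L"
  obtains k where "nat \<bar>int n - int k\<bar> \<le> L"
    "1 / (4 * real L + 2) \<le> measure_pmf.prob (xi_copies b \<theta> N) {x. (\<Sum>j=1..N. x j) = k}"
proof -
  define m where "m = xi_mean b \<theta>"
  define P where "P = xi_copies b \<theta> N"
  let ?S = "\<lambda>x :: nat \<Rightarrow> nat. (\<Sum>j=1..N. x j)"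
  define I where "I = {n - L..n + L}"
  have dev: "(\<Sum>j=1..N. real (x j) - m) = real (?S x) - real n" for x :: "nat \<Rightarrow> nat"
    using N(2) by (simp add: sum_subtractf m_def)
  have "integrable (xi_law b \<theta>) (\<lambda>k. real k - m)"
    "measure_pmf.expectation (xi_law b \<theta>) (\<lambda>k. real k - m) = 0"
    using mean_integrable[OF \<theta>] by (auto simp: m_def xi_mean_def)
  from iid_two_sided_tail[OF _ this, where l = "1 / sqrt N" and V = V and A = "{1..N}" and d = 0 and t = "(V / 2 + 2) * sqrt N"]
  have "measure_pmf.prob P {x. (V / 2 + 2) * sqrt N \<le> \<bar>real (?S x) - real n\<bar>}
      \<le> 2 * exp (- (1 / sqrt N) * ((V / 2 + 2) * sqrt N) + real N * ((1 / sqrt N)\<^sup>2 * V / 2))"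
    unfolding dev[symmetric] using int V N(1) by (simp add: P_def xi_copies_def m_def)
  also have "- (1 / sqrt N) * ((V / 2 + 2) * sqrt N) + real N * ((1 / sqrt N)\<^sup>2 * V / 2) = - 2"
    using N(1) by (simp add: power_divide)
  also have "2 * exp (- 2) \<le> (1 / 2 :: real)"
    using exp_lower_Taylor_quadratic[of 2] by (simp add: exp_minus field_simps)
  finally have far: "measure_pmf.prob P {x. (V / 2 + 2) * sqrt N \<le> \<bar>real (?S x) - real n\<bar>} \<le> 1 / 2" .
  have "1 - measure_pmf.prob P {x. (V / 2 + 2) * sqrt N \<le> \<bar>real (?S x) - real n\<bar>}
      = measure_pmf.prob P (UNIV - {x. (V / 2 + 2) * sqrt N \<le> \<bar>real (?S x) - real n\<bar>})"
    by (subst measure_pmf.prob_compl[symmetric]) auto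
  also have "\<dots> \<le> measure_pmf.prob P (\<Union>k\<in>I. {x. ?S x = k})"
  proof (intro measure_pmf.finite_measure_mono subsetI)
    fix x assume "x \<in> UNIV - {x. (V / 2 + 2) * sqrt N \<le> \<bar>real (?S x) - real n\<bar>}"
    then have "\<bar>real (?S x) - real n\<bar> < real L" using L by (auto simp del: of_nat_sum)
    then have "?S x \<in> I" unfolding I_def atLeastAtMost_iff by linarith
    then show "x \<in> (\<Union>k\<in>I. {x. ?S x = k})" by blast
  qed simp
  also have "\<dots> \<le> (\<Sum>k\<in>I. measure_pmf.prob P {x. ?S x = k})"
    by (intro measure_UNION_le) (auto simp: I_def)
  finally have half: "1 / 2 \<le> (\<Sum>k\<in>I. measure_pmf.prob P {x. ?S x = k})" using far by linarith
  have "\<exists>k\<in>I. 1 / (4 * real L + 2) \<le> measure_pmf.prob P {x. ?S x = k}"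
  proof (rule ccontr)
    assume "\<not> ?thesis"
    then have "(\<Sum>k\<in>I. measure_pmf.prob P {x. ?S x = k}) < (\<Sum>k\<in>I. 1 / (4 * real L + 2))"
      by (intro sum_strict_mono) (auto simp: I_def not_le)
    also have "\<dots> = real (card I) * (1 / (4 * real L + 2))" by simp
    also have "\<dots> \<le> (2 * real L + 1) * (1 / (4 * real L + 2))"
      by (intro mult_right_mono) (auto simp: I_def)
    also have "\<dots> = 1 / 2" by (simp add: field_simps)
    finally show False using half by simp
  qed
  then obtain k where "k \<in> I" "1 / (4 * real L + 2) \<le> measure_pmf.prob P {x. ?S x = k}" by blast
  moreover have "nat \<bar>int n - int k\<bar> \<le> L" using \<open>k \<in> I\<close> by (auto simp: I_def)
  ultimately show ?thesis using that by (simp add: P_def)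
qed

text \<open>Starting from a total with large probability, at distance \<open>O(sqrt N)\<close>, the Harnack walk reaches
\<open>n\<close>. Every constant involved depends on \<open>\<theta>\<close> only through \<open>\<theta>\<^sub>1\<close> and \<open>\<theta>\<^sub>2\<close>, which makes the
threshold for \<open>N\<close> uniform.\<close>

lemma local_lower_bound:
  assumes \<theta>\<^sub>2: "\<theta>\<^sub>2 \<in> param_range b" and \<theta>\<^sub>1: "0 < \<theta>\<^sub>1"
  shows "\<forall>\<^sub>F N in sequentially. \<forall>\<theta> n. \<theta>\<^sub>1 \<le> \<theta> \<longrightarrow> \<theta> \<le> \<theta>\<^sub>2 \<longrightarrow> real N * xi_mean b \<theta> = real n \<longrightarrow>
           1 / real N \<le> measure_pmf.prob (xi_copies b \<theta> N) {x. (\<Sum>j=1..N. x j) = n}"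
proof -
  obtain l\<^sub>0 V where l\<^sub>0: "0 < l\<^sub>0" and "0 < V"
    and V: "\<And>\<theta> l. 0 < \<theta> \<Longrightarrow> \<theta> \<le> \<theta>\<^sub>2 \<Longrightarrow> 0 \<le> l \<Longrightarrow> l \<le> l\<^sub>0 \<Longrightarrow>
        integrable (xi_law b \<theta>) (\<lambda>k. (real k - xi_mean b \<theta>)\<^sup>2 * exp (l * \<bar>real k - xi_mean b \<theta>\<bar>))
      \<and> measure_pmf.expectation (xi_law b \<theta>)
          (\<lambda>k. (real k - xi_mean b \<theta>)\<^sup>2 * exp (l * \<bar>real k - xi_mean b \<theta>\<bar>)) \<le> V"
    by (rule exponential_second_moment[OF \<theta>\<^sub>2]) blast
  obtain \<delta>\<^sub>0 where \<delta>\<^sub>0: "0 < \<delta>\<^sub>0" "\<And>\<theta>. \<theta>\<^sub>1 \<le> \<theta> \<Longrightarrow> \<theta> \<le> \<theta>\<^sub>2 \<Longrightarrow> \<delta>\<^sub>0 \<le> pmf (xi_law b \<theta>) 0"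
    using point_probabilities_bounded_below[OF \<theta>\<^sub>2 \<theta>\<^sub>1 pos0] by blast
  obtain \<delta>\<^sub>1 where \<delta>\<^sub>1: "0 < \<delta>\<^sub>1" "\<And>\<theta>. \<theta>\<^sub>1 \<le> \<theta> \<Longrightarrow> \<theta> \<le> \<theta>\<^sub>2 \<Longrightarrow> \<delta>\<^sub>1 \<le> pmf (xi_law b \<theta>) 1"
    using point_probabilities_bounded_below[OF \<theta>\<^sub>2 \<theta>\<^sub>1 pos1] by blast
  define C where "C = 1 / min \<delta>\<^sub>0 \<delta>\<^sub>1"
  define c where "c = V / 2 + 2"
  have C: "0 < C" and c: "0 < c" using \<delta>\<^sub>0 \<delta>\<^sub>1 \<open>0 < V\<close> by (auto simp: C_def c_def)
  define \<tau> where "\<tau> x = sqrt (8 * ln x / x)" for x :: real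
  have ev: "\<forall>\<^sub>F x in at_top. 1 / x \<le> (1 - 2 * (C * \<tau> x)) powr (c * sqrt x + 1) / (4 * (c * sqrt x + 1) + 2)
       - (c * sqrt x + 1) * (4 * C / x ^ 4)"
    unfolding \<tau>_def by (rule walk_loss_negligible[OF C c])
  have "\<forall>\<^sub>F x in at_top. C * \<tau> x < 1 / 4" "\<forall>\<^sub>F x in at_top. \<tau> x \<le> 1"
    "\<forall>\<^sub>F x in at_top. 1 / sqrt x \<le> l\<^sub>0" "\<forall>\<^sub>F x in at_top. (1::real) < x"
    unfolding \<tau>_def using C l\<^sub>0 by real_asymp+
  with ev have "\<forall>\<^sub>F x in at_top. 1 / x \<le> (1 - 2 * (C * \<tau> x)) powr (c * sqrt x + 1) / (4 * (c * sqrt x + 1) + 2)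
       - (c * sqrt x + 1) * (4 * C / x ^ 4) \<and> C * \<tau> x < 1 / 4 \<and> \<tau> x \<le> 1 \<and> 1 / sqrt x \<le> l\<^sub>0 \<and> 1 < x"
    by eventually_elim simp
  from eventually_compose_filterlim[OF this filterlim_real_sequentially] show ?thesis
  proof eventually_elim
    case (elim N)
    show ?case
    proof (intro allI impI)
      fix \<theta> n
      assume th: "\<theta>\<^sub>1 \<le> \<theta>" "\<theta> \<le> \<theta>\<^sub>2" and n: "real N * xi_mean b \<theta> = real n"
      have \<theta>: "\<theta> \<in> param_range b" using param_range_downward[OF \<theta>\<^sub>2] th \<theta>\<^sub>1 by auto
      have N: "0 < N" "1 < real N" using elim by auto
      define u where "u k = measure_pmf.prob (xi_copies b \<theta> N) {x. (\<Sum>j=1..N. x j) = k}" for k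
      define L where "L = nat \<lceil>c * sqrt N\<rceil>"
      have L: "c * sqrt N \<le> L" "L \<le> c * sqrt N + 1"
        using c of_int_ceiling_le_add_one[of "c * sqrt N"]
        by (auto simp: L_def real_nat_ceiling_ge)
      obtain k where k: "nat \<bar>int n - int k\<bar> \<le> L" "1 / (4 * real L + 2) \<le> u k"
        using sum_law_heavy_point[OF \<theta> N(1) n _ _ L(1)[unfolded c_def]] V[of \<theta> "1 / sqrt N"] th \<theta>\<^sub>1 elim
        unfolding u_def by auto
      define t where "t = \<tau> N"
      have t: "0 < t" "t \<le> 1" "C * t < 1 / 4" using elim N by (auto simp: t_def \<tau>_def)
      have "exp (- real N * t\<^sup>2 / 2) = exp (- 4 * ln (real N))"
        using N by (simp add: t_def \<tau>_def)
      also have "\<dots> = 1 / real N ^ 4"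
        using N exp_of_nat_mult[of 4 "ln (real N)"] by (simp add: exp_minus field_simps)
      finally have expt: "exp (- real N * t\<^sup>2 / 2) = 1 / real N ^ 4" .
      define e where "e = 4 * C / real N ^ 4"
      have "\<bar>u (Suc k) - u k\<bar> \<le> (C * t) * (u k + u (Suc k)) + e" for k
        using sum_law_step[of "{1..N}" "min \<delta>\<^sub>0 \<delta>\<^sub>1" "xi_law b \<theta>" t k] \<delta>\<^sub>0 \<delta>\<^sub>1 th t N expt
        by (simp add: u_def xi_copies_def C_def e_def add_divide_distrib min.coboundedI1 min.coboundedI2 mult_ac)
      then have "(1 - 2 * (C * t)) ^ L * u k - real L * e \<le> u n"
        by (rule harnack_walk) (use t C N k in \<open>auto simp: u_def e_def\<close>)
      moreover have "(1 - 2 * (C * t)) powr (c * sqrt N + 1) / (4 * (c * sqrt N + 1) + 2)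
          \<le> (1 - 2 * (C * t)) ^ L * u k"
      proof -
        have q: "0 < 1 - 2 * (C * t)" "1 - 2 * (C * t) \<le> 1" using t C by auto
        have "(1 - 2 * (C * t)) powr (c * sqrt N + 1) \<le> (1 - 2 * (C * t)) powr real L"
          using q L by (intro powr_mono') auto
        also have "\<dots> = (1 - 2 * (C * t)) ^ L" using q by (simp add: powr_realpow)
        finally have "(1 - 2 * (C * t)) powr (c * sqrt N + 1) * (1 / (4 * (c * sqrt N + 1) + 2))
          \<le> (1 - 2 * (C * t)) ^ L * (1 / (4 * real L + 2))"
          using q L c by (intro mult_mono divide_left_mono) auto
        also have "\<dots> \<le> (1 - 2 * (C * t)) ^ L * u k"
          using k q by (intro mult_left_mono) auto
        finally show ?thesis by simp
      qed
      moreover have "real L * e \<le> (c * sqrt N + 1) * e"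
        using L C by (intro mult_right_mono) (auto simp: e_def)
      ultimately show "1 / real N \<le> measure_pmf.prob (xi_copies b \<theta> N) {x. (\<Sum>j=1..N. x j) = n}"
        using elim unfolding u_def[symmetric] t_def e_def by linarith
    qed
  qed
qed

end

section \<open>From the independent model to the allocation scheme\<close>

text \<open>On configurations with a fixed total, changing the parameter multiplies all probabilities by the
same factor; conditioning on the total cancels it. This is why the scheme does not depend on the
parameters and why they may be adapted to \<open>n\<close>.\<close>

lemma (in weight_sequence) prob_fixed_sum_change_parameter:
  assumes \<theta>: "\<theta> \<in> param_range b" and \<phi>: "\<phi> \<in> param_range b"
    and A: "A \<subseteq> {x. (\<Sum>j=1..N. x j) = n}"
  shows "measure_pmf.prob (xi_copies b \<theta> N) A
       = (\<theta> / \<phi>) ^ n * (B_series b \<phi> / B_series b \<theta>) ^ N * measure_pmf.prob (xi_copies b \<phi> N) A"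
proof -
  have pos: "0 < \<theta>" "0 < \<phi>" using \<theta> \<phi> by (auto simp: param_range_def)
  note B = B_pos[OF \<theta>] B_pos[OF \<phi>]
  have "pmf (xi_copies b \<theta> N) x
      = (\<theta> / \<phi>) ^ n * (B_series b \<phi> / B_series b \<theta>) ^ N * pmf (xi_copies b \<phi> N) x"
    if "x \<in> A" for x
  proof (cases "\<forall>j. j \<notin> {1..N} \<longrightarrow> x j = 0")
    case True
    have n: "n = (\<Sum>j=1..N. x j)" using A that by auto
    have one: "pmf (xi_law b \<theta>) k
        = (\<theta> / \<phi>) ^ k * (B_series b \<phi> / B_series b \<theta>) * pmf (xi_law b \<phi>) k" for k
      using pos B by (simp add: pmf_xi[OF \<theta>] pmf_xi[OF \<phi>] power_divide field_simps)
    have "pmf (xi_copies b \<theta> N) x = (\<Prod>j=1..N. pmf (xi_law b \<theta>) (x j))"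
      using True by (simp add: xi_copies_def pmf_Pi)
    also have "\<dots> = (\<Prod>j=1..N. (\<theta> / \<phi>) ^ x j * (B_series b \<phi> / B_series b \<theta>) * pmf (xi_law b \<phi>) (x j))"
      by (simp only: one)
    also have "\<dots> = (\<theta> / \<phi>) ^ n * (B_series b \<phi> / B_series b \<theta>) ^ N
        * (\<Prod>j=1..N. pmf (xi_law b \<phi>) (x j))"
      by (simp only: prod.distrib n power_sum prod_constant card_atLeastAtMost) simp
    also have "(\<Prod>j=1..N. pmf (xi_law b \<phi>) (x j)) = pmf (xi_copies b \<phi> N) x"
      using True by (simp add: xi_copies_def pmf_Pi)
    finally show ?thesis .
  qed (auto simp: xi_copies_def pmf_Pi)
  then have "measure_pmf.prob (xi_copies b \<theta> N) A = infsetsum (\<lambda>x.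
      ((\<theta> / \<phi>) ^ n * (B_series b \<phi> / B_series b \<theta>) ^ N) * pmf (xi_copies b \<phi> N) x) A"
    unfolding measure_pmf_conv_infsetsum by (intro infsetsum_cong) auto
  then show ?thesis
    by (simp add: infsetsum_cmult_right pmf_abs_summable measure_pmf_conv_infsetsum)
qed

lemma (in weight_sequence) cond_prob_change_parameter:
  assumes \<theta>: "\<theta> \<in> param_range b" and \<phi>: "\<phi> \<in> param_range b"
  shows "cond_prob (xi_copies b \<theta> N) Q (\<lambda>x. (\<Sum>j=1..N. x j) = n)
       = cond_prob (xi_copies b \<phi> N) Q (\<lambda>x. (\<Sum>j=1..N. x j) = n)"
proof -
  define c where "c = (\<theta> / \<phi>) ^ n * (B_series b \<phi> / B_series b \<theta>) ^ N"
  have "0 < c"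
    using \<theta> \<phi> B_pos[OF \<theta>] B_pos[OF \<phi>] by (auto simp: c_def param_range_def)
  have "measure_pmf.prob (xi_copies b \<theta> N) {x. R x \<and> (\<Sum>j=1..N. x j) = n}
      = c * measure_pmf.prob (xi_copies b \<phi> N) {x. R x \<and> (\<Sum>j=1..N. x j) = n}" for R
    unfolding c_def by (rule prob_fixed_sum_change_parameter[OF \<theta> \<phi>]) auto
  from this[of Q] this[of "\<lambda>_. True"] \<open>0 < c\<close> show ?thesis
    by (simp add: cond_prob_def)
qed

definition box_law :: "('c::finite \<Rightarrow> nat \<Rightarrow> real) \<Rightarrow> ('c \<Rightarrow> real) \<Rightarrow> ('c \<Rightarrow> nat) pmf" where
  "box_law b \<theta> = Pi_pmf UNIV 0 (\<lambda>i. xi_law (b i) (\<theta> i))"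

definition config_law ::
  "('c::finite \<Rightarrow> nat \<Rightarrow> real) \<Rightarrow> ('c \<Rightarrow> real) \<Rightarrow> nat \<Rightarrow> (nat \<Rightarrow> 'c \<Rightarrow> nat) pmf" where
  "config_law b \<theta> N = Pi_pmf {1..N} (\<lambda>_. 0) (\<lambda>_. box_law b \<theta>)"

lemma pmf_box_law: "pmf (box_law b \<theta>) s = (\<Prod>i\<in>UNIV. pmf (xi_law (b i) (\<theta> i)) (s i))"
  by (simp add: box_law_def pmf_Pi)

lemma pmf_config_law:
  "pmf (config_law b \<theta> N) k = (\<Prod>i\<in>UNIV. pmf (xi_copies (b i) (\<theta> i) N) (\<lambda>j. k j i))"
proof (cases "\<forall>j. j \<notin> {1..N} \<longrightarrow> k j = (\<lambda>_. 0)")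
  case True
  have "pmf (config_law b \<theta> N) k = (\<Prod>j=1..N. \<Prod>i\<in>UNIV. pmf (xi_law (b i) (\<theta> i)) (k j i))"
    using True by (simp add: config_law_def pmf_Pi pmf_box_law)
  also have "\<dots> = (\<Prod>i\<in>UNIV. \<Prod>j=1..N. pmf (xi_law (b i) (\<theta> i)) (k j i))"
    by (rule prod.swap)
  also have "\<dots> = (\<Prod>i\<in>UNIV. pmf (xi_copies (b i) (\<theta> i) N) (\<lambda>j. k j i))"
    using True by (intro prod.cong) (simp_all add: xi_copies_def pmf_Pi)
  finally show ?thesis .
next
  case False
  then obtain j i where "j \<notin> {1..N}" "k j i \<noteq> 0" by (auto simp: fun_eq_iff)
  then have "pmf (xi_copies (b i) (\<theta> i) N) (\<lambda>j. k j i) = 0"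
    by (auto simp: xi_copies_def intro!: pmf_Pi_outside)
  moreover have "pmf (config_law b \<theta> N) k = 0"
    using False by (auto simp: config_law_def intro!: pmf_Pi_outside)
  ultimately show ?thesis by (auto intro!: prod_zero[symmetric])
qed

text \<open>The independent model is a product over boxes (used for the tails of \<open>\<mu>\<close>) and equally a product
over colours (used for the conditioning event).\<close>

lemma config_law_by_colours:
  "config_law b \<theta> N
     = map_pmf (\<lambda>g j i. g i j) (Pi_pmf UNIV (\<lambda>_. 0) (\<lambda>i. xi_copies (b i) (\<theta> i) N))"
proof (rule pmf_eqI)
  fix k :: "nat \<Rightarrow> 'a \<Rightarrow> nat"
  have "inj (\<lambda>g j i. g i j :: nat)" by (auto intro!: injI simp: fun_eq_iff)
  from pmf_map_inj'[OF this, of "Pi_pmf UNIV (\<lambda>_. 0) (\<lambda>i. xi_copies (b i) (\<theta> i) N)" "\<lambda>i j. k j i"]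
  show "pmf (config_law b \<theta> N) k = pmf (map_pmf (\<lambda>g j i. g i j)
      (Pi_pmf UNIV (\<lambda>_. 0) (\<lambda>i. xi_copies (b i) (\<theta> i) N))) k"
    by (simp add: pmf_config_law pmf_Pi)
qed

lemma prob_config_sums:
  "measure_pmf.prob (config_law b \<theta> N) {k. \<forall>i. (\<Sum>j=1..N. k j i) = n i}
     = (\<Prod>i\<in>UNIV. measure_pmf.prob (xi_copies (b i) (\<theta> i) N) {x. (\<Sum>j=1..N. x j) = n i})"
proof -
  have "(\<lambda>g j i. g i j) -` {k. \<forall>i. (\<Sum>j=1..N. k j i) = n i}
      = Pi UNIV (\<lambda>i. {x. (\<Sum>j=1..N. x j) = n i})" by auto
  then show ?thesis
    by (simp add: config_law_by_colours measure_Pi_pmf_Pi)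
qed

text \<open>Outside \<open>{1..N}\<close> the configuration gets the default value of \<^const>\<open>config_law\<close>, so that the
two can be compared as functions on all of \<^typ>\<open>nat\<close>.\<close>

definition occupancy :: "nat \<Rightarrow> (nat \<Rightarrow> 'a \<Rightarrow> 'c \<Rightarrow> nat) \<Rightarrow> 'a \<Rightarrow> nat \<Rightarrow> 'c \<Rightarrow> nat" where
  "occupancy N \<eta> \<omega> = (\<lambda>j. if j \<in> {1..N} then \<eta> j \<omega> else (\<lambda>_. 0))"

definition configurations :: "('c \<Rightarrow> nat) \<Rightarrow> nat \<Rightarrow> (nat \<Rightarrow> 'c \<Rightarrow> nat) set" where
  "configurations n N = {k. (\<forall>j. j \<notin> {1..N} \<longrightarrow> k j = (\<lambda>_. 0)) \<and> (\<forall>i. (\<Sum>j=1..N. k j i) = n i)}"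

lemma finite_configurations:
  fixes n :: "'c::finite \<Rightarrow> nat"
  shows "finite (configurations n N)"
proof (rule finite_subset)
  have "k j i \<le> n i" if "k \<in> configurations n N" "j \<in> {1..N}" for k j i
    using that member_le_sum[of j "{1..N}" "\<lambda>j. k j i"] by (auto simp: configurations_def)
  then show "configurations n N \<subseteq> PiE_dflt {1..N} (\<lambda>_. 0) (\<lambda>_. PiE UNIV (\<lambda>i. {..n i}))"
    by (auto simp: PiE_dflt_def configurations_def)
  show "finite (PiE_dflt {1..N} (\<lambda>_. 0) (\<lambda>_. PiE UNIV (\<lambda>i. {..n i})))"
    by (intro finite_PiE_dflt finite_PiE) auto
qed

lemma occupancy_eq_measurable:
  fixes N :: nat
  assumes "\<And>j. j \<in> {1..N} \<Longrightarrow> \<eta> j \<in> measurable M (count_space UNIV)"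
  shows "{\<omega> \<in> space M. \<forall>j\<in>{1..N}. \<eta> j \<omega> = k j} \<in> sets M"
proof -
  have "{\<omega> \<in> space M. \<eta> j \<omega> = k j} \<in> sets M" if "j \<in> {1..N}" for j
    using measurable_sets[OF assms[OF that], of "{k j}"] by (simp add: vimage_def Int_def conj_commute)
  then show ?thesis by (intro sets.sets_Collect_finite_All) simp_all
qed

lemma allocation_point_prob:
  assumes scheme: "allocation_scheme M b n N \<eta>"
    and ws: "\<And>i. weight_sequence (b i)" and \<theta>: "\<And>i. \<theta> i \<in> param_range (b i)"
    and k: "k \<in> configurations n N"
  shows "measure M {\<omega> \<in> space M. occupancy N \<eta> \<omega> = k}
       = pmf (config_law b \<theta> N) k
         / (\<Prod>i\<in>UNIV. measure_pmf.prob (xi_copies (b i) (\<theta> i) N) {x. (\<Sum>j=1..N. x j) = n i})"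
proof -
  obtain \<phi> where \<phi>: "\<And>i. \<phi> i \<in> param_range (b i)" and law:
    "\<And>k. (\<forall>i. (\<Sum>j=1..N. k j i) = n i) \<Longrightarrow>
       measure M {\<omega> \<in> space M. \<forall>j\<in>{1..N}. \<eta> j \<omega> = k j} =
          (\<Prod>i\<in>UNIV. cond_prob (measure_pmf (xi_copies (b i) (\<phi> i) N))
             (\<lambda>x. \<forall>j\<in>{1..N}. x j = k j i) (\<lambda>x. (\<Sum>j=1..N. x j) = n i))"
    using scheme unfolding allocation_scheme_def by blast
  have supp: "\<And>j. j \<notin> {1..N} \<Longrightarrow> k j = (\<lambda>_. 0)" and sum: "\<And>i. (\<Sum>j=1..N. k j i) = n i"
    using k by (auto simp: configurations_def)
  have "(occupancy N \<eta> \<omega> = k) = (\<forall>j\<in>{1..N}. \<eta> j \<omega> = k j)" for \<omega>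
    using supp by (auto simp: occupancy_def fun_eq_iff)
  then have "measure M {\<omega> \<in> space M. occupancy N \<eta> \<omega> = k}
      = (\<Prod>i\<in>UNIV. cond_prob (measure_pmf (xi_copies (b i) (\<theta> i) N))
             (\<lambda>x. \<forall>j\<in>{1..N}. x j = k j i) (\<lambda>x. (\<Sum>j=1..N. x j) = n i))"
    using law[of k] sum weight_sequence.cond_prob_change_parameter[OF ws \<theta> \<phi>] by simp
  also have "\<dots> = (\<Prod>i\<in>UNIV. pmf (xi_copies (b i) (\<theta> i) N) (\<lambda>j. k j i)
      / measure_pmf.prob (xi_copies (b i) (\<theta> i) N) {x. (\<Sum>j=1..N. x j) = n i})"
  proof (intro prod.cong refl)
    fix i
    have "measure_pmf.prob (xi_copies (b i) (\<theta> i) N) {x. (\<forall>j\<in>{1..N}. x j = k j i) \<and> (\<Sum>j=1..N. x j) = n i}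
        = measure_pmf.prob (xi_copies (b i) (\<theta> i) N) {\<lambda>j. k j i}"
    proof (rule measure_prob_cong_0)
      fix x assume "x \<in> {x. (\<forall>j\<in>{1..N}. x j = k j i) \<and> (\<Sum>j=1..N. x j) = n i} - {\<lambda>j. k j i}"
      then obtain j where "j \<notin> {1..N}" "x j \<noteq> 0"
        using supp by (auto simp: fun_eq_iff)
      then show "pmf (xi_copies (b i) (\<theta> i) N) x = 0"
        by (auto simp: xi_copies_def intro!: pmf_Pi_outside)
    qed (use sum in auto)
    then show "cond_prob (measure_pmf (xi_copies (b i) (\<theta> i) N))
             (\<lambda>x. \<forall>j\<in>{1..N}. x j = k j i) (\<lambda>x. (\<Sum>j=1..N. x j) = n i)
        = pmf (xi_copies (b i) (\<theta> i) N) (\<lambda>j. k j i)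
          / measure_pmf.prob (xi_copies (b i) (\<theta> i) N) {x. (\<Sum>j=1..N. x j) = n i}"
      by (simp add: cond_prob_def measure_pmf_single)
  qed
  finally show ?thesis by (simp add: prod_dividef pmf_config_law)
qed

text \<open>The definition of an allocation scheme fixes the probabilities of the finitely many
configurations with the right totals. These probabilities already add up to one, hence everything
else is negligible, and the rest is the bound \<open>P(A | B) \<le> P(A) / P(B)\<close>.\<close>

lemma allocation_conditioning_bound:
  assumes "prob_space M" and scheme: "allocation_scheme M b n N \<eta>"
    and ws: "\<And>i. weight_sequence (b i)" and \<theta>: "\<And>i. \<theta> i \<in> param_range (b i)"
    and z: "z = (\<Prod>i\<in>UNIV. measure_pmf.prob (xi_copies (b i) (\<theta> i) N) {x. (\<Sum>j=1..N. x j) = n i})"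
    and pos: "0 < z"
    and W: "{\<omega> \<in> space M. occupancy N \<eta> \<omega> \<in> W} \<in> sets M"
  shows "measure M {\<omega> \<in> space M. occupancy N \<eta> \<omega> \<in> W} \<le> measure_pmf.prob (config_law b \<theta> N) W / z"
proof -
  interpret prob_space M by fact
  let ?X = "occupancy N \<eta>" and ?F = "configurations n N" and ?P = "config_law b \<theta> N"
  have fin: "finite ?F" by (rule finite_configurations)
  have meas: "\<And>j. j \<in> {1..N} \<Longrightarrow> \<eta> j \<in> measurable M (count_space UNIV)"
    using scheme by (auto simp: allocation_scheme_def)
  have ev: "{\<omega> \<in> space M. ?X \<omega> = k} \<in> sets M" if "k \<in> ?F" for k
  proof -
    have "(?X \<omega> = k) = (\<forall>j\<in>{1..N}. \<eta> j \<omega> = k j)" for \<omega>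
      using that by (auto simp: occupancy_def configurations_def fun_eq_iff)
    then show ?thesis using occupancy_eq_measurable[where N = N and k = k and \<eta> = \<eta> and M = M] meas by simp
  qed
  have part: "prob {\<omega> \<in> space M. ?X \<omega> \<in> G} = measure_pmf.prob ?P G / z"
    and part_sets: "{\<omega> \<in> space M. ?X \<omega> \<in> G} \<in> sets M" if G: "G \<subseteq> ?F" for G
  proof -
    have finG: "finite G" using G fin by (rule finite_subset)
    have eq: "{\<omega> \<in> space M. ?X \<omega> \<in> G} = (\<Union>k\<in>G. {\<omega> \<in> space M. ?X \<omega> = k})" by auto
    show "{\<omega> \<in> space M. ?X \<omega> \<in> G} \<in> sets M"
      unfolding eq using finG ev G by (intro sets.finite_UN) auto
    have "prob {\<omega> \<in> space M. ?X \<omega> \<in> G} = (\<Sum>k\<in>G. prob {\<omega> \<in> space M. ?X \<omega> = k})"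
      unfolding eq using finG ev G
      by (intro finite_measure_finite_Union) (auto simp: disjoint_family_on_def)
    also have "\<dots> = (\<Sum>k\<in>G. pmf ?P k / z)"
      using allocation_point_prob[OF scheme ws \<theta>] G z by (intro sum.cong) auto
    also have "\<dots> = measure_pmf.prob ?P G / z"
      by (simp add: sum_divide_distrib[symmetric] measure_measure_pmf_finite[OF finG])
    finally show "prob {\<omega> \<in> space M. ?X \<omega> \<in> G} = measure_pmf.prob ?P G / z" .
  qed
  have "measure_pmf.prob ?P ?F = measure_pmf.prob ?P {k. \<forall>i. (\<Sum>j=1..N. k j i) = n i}"
    by (rule measure_prob_cong_0)
       (auto simp: configurations_def config_law_def intro!: pmf_Pi_outside)
  then have one: "prob {\<omega> \<in> space M. ?X \<omega> \<in> ?F} = 1"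
    using part[of ?F] pos prob_config_sums[of b \<theta> N n, folded z] by simp
  have "prob {\<omega> \<in> space M. ?X \<omega> \<in> W}
      \<le> prob ({\<omega> \<in> space M. ?X \<omega> \<in> W \<inter> ?F} \<union> (space M - {\<omega> \<in> space M. ?X \<omega> \<in> ?F}))"
    using part_sets[of "W \<inter> ?F"] part_sets[of ?F] by (intro finite_measure_mono) auto
  also have "\<dots> \<le> prob {\<omega> \<in> space M. ?X \<omega> \<in> W \<inter> ?F} + prob (space M - {\<omega> \<in> space M. ?X \<omega> \<in> ?F})"
    using part_sets[of "W \<inter> ?F"] part_sets[of ?F] by (intro measure_Un_le) auto
  also have "prob (space M - {\<omega> \<in> space M. ?X \<omega> \<in> ?F}) = 0"
    using prob_compl[OF part_sets[of ?F]] one by simp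
  also have "prob {\<omega> \<in> space M. ?X \<omega> \<in> W \<inter> ?F} \<le> measure_pmf.prob ?P W / z"
    using part[of "W \<inter> ?F"] pos
    by (auto intro!: divide_right_mono measure_pmf.finite_measure_mono)
  finally show ?thesis by simp
qed

lemma box_count_occupancy:
  "box_count \<eta> s N \<omega> = (\<Sum>j\<in>{1..N}. of_bool (occupancy N \<eta> \<omega> j = s))"
proof -
  have "(\<Prod>i\<in>UNIV. indicator {\<omega>'. \<eta> j \<omega>' i = s i} \<omega>) = (of_bool (\<eta> j \<omega> = s) :: real)" for j
    by (cases "\<eta> j \<omega> = s") (auto simp: fun_eq_iff indicator_def)
  then show ?thesis
    unfolding box_count_def by (intro sum.cong) (auto simp: occupancy_def)
qed

lemma box_count_bounds: "0 \<le> box_count \<eta> s N \<omega>" "box_count \<eta> s N \<omega> \<le> real N"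
proof -
  show "0 \<le> box_count \<eta> s N \<omega>" unfolding box_count_occupancy by (simp add: sum_nonneg)
  show "box_count \<eta> s N \<omega> \<le> real N"
    unfolding box_count_occupancy
    using sum_bounded_above[of "{1..N}" "\<lambda>j. of_bool (occupancy N \<eta> \<omega> j = s) :: real" 1] by simp
qed

lemma box_count_measurable:
  assumes "allocation_scheme M b n N \<eta>"
  shows "box_count \<eta> s N \<in> borel_measurable M"
proof -
  have "(\<lambda>\<omega>. of_bool (\<eta> j \<omega> = s) :: real) \<in> borel_measurable M" if "j \<in> {1..N}" for j
  proof (rule measurable_compose[of "\<eta> j" M "count_space UNIV" "\<lambda>v. of_bool (v = s)"])
    show "\<eta> j \<in> measurable M (count_space UNIV)"
      using assms that by (auto simp: allocation_scheme_def)
  qed simp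
  then have "(\<lambda>\<omega>. \<Sum>j\<in>{1..N}. of_bool (\<eta> j \<omega> = s) :: real) \<in> borel_measurable M" by measurable
  moreover have "box_count \<eta> s N = (\<lambda>\<omega>. \<Sum>j\<in>{1..N}. of_bool (\<eta> j \<omega> = s))"
    unfolding box_count_occupancy[abs_def] by (auto simp: occupancy_def)
  ultimately show ?thesis by simp
qed

lemma box_count_tail:
  assumes "prob_space M" and scheme: "allocation_scheme M b n N \<eta>"
    and ws: "\<And>i. weight_sequence (b i)" and \<theta>: "\<And>i. \<theta> i \<in> param_range (b i)"
    and z: "z = (\<Prod>i\<in>UNIV. measure_pmf.prob (xi_copies (b i) (\<theta> i) N) {x. (\<Sum>j=1..N. x j) = n i})"
    and pos: "0 < z" and l: "0 < l" and p: "p = pmf (box_law b \<theta>) s"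
  shows "measure M {\<omega> \<in> space M. t \<le> \<bar>box_count \<eta> s N \<omega> - real N * p\<bar>}
       \<le> 2 * exp (- l * t + real N * (l\<^sup>2 * (p * (1 - p) * exp l) / 2)) / z"
proof -
  define W where "W = {k :: nat \<Rightarrow> 'b \<Rightarrow> nat. t \<le> \<bar>(\<Sum>j\<in>{1..N}. of_bool (k j = s)) - real N * p\<bar>}"
  have eq: "{\<omega> \<in> space M. t \<le> \<bar>box_count \<eta> s N \<omega> - real N * p\<bar>} = {\<omega> \<in> space M. occupancy N \<eta> \<omega> \<in> W}"
    by (simp only: box_count_occupancy W_def mem_Collect_eq)
  have [measurable]: "box_count \<eta> s N \<in> borel_measurable M" by (rule box_count_measurable[OF scheme])
  have sets: "{\<omega> \<in> space M. t \<le> \<bar>box_count \<eta> s N \<omega> - real N * p\<bar>} \<in> sets M" by measurable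
  have "measure_pmf.prob (config_law b \<theta> N) W \<le> 2 * exp (- l * t + real N * (l\<^sup>2 * (p * (1 - p) * exp l) / 2))"
    using count_tail[OF _ l, of "{1..N}" "\<lambda>_. 0" "box_law b \<theta>" t s]
    by (simp add: W_def config_law_def p)
  then have "measure_pmf.prob (config_law b \<theta> N) W / z
      \<le> 2 * exp (- l * t + real N * (l\<^sup>2 * (p * (1 - p) * exp l) / 2)) / z"
    using pos by (intro divide_right_mono) auto
  then show ?thesis
    using allocation_conditioning_bound[OF assms(1) scheme ws \<theta> z pos, of W] sets
    unfolding eq by linarith
qed

text \<open>The deviation of the expectation is controlled by the tail itself: \<open>\<bar>\<mu> - N p\<bar>\<close> is below \<open>t\<close> off the
deviation event, and at most \<open>N\<close> on it.\<close>

lemma box_count_mean_deviation: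
  assumes "prob_space M" and scheme: "allocation_scheme M b n N \<eta>"
    and p: "0 \<le> p" "p \<le> 1" and t: "0 \<le> t"
  shows "\<bar>(\<integral>\<omega>. box_count \<eta> s N \<omega> \<partial>M) - real N * p\<bar>
       \<le> t + real N * measure M {\<omega> \<in> space M. t \<le> \<bar>box_count \<eta> s N \<omega> - real N * p\<bar>}"
proof -
  interpret prob_space M by fact
  define D where "D = {\<omega> \<in> space M. t \<le> \<bar>box_count \<eta> s N \<omega> - real N * p\<bar>}"
  have [measurable]: "box_count \<eta> s N \<in> borel_measurable M" by (rule box_count_measurable[OF scheme])
  have D[measurable]: "D \<in> sets M" unfolding D_def by measurable
  have int: "integrable M (box_count \<eta> s N)"
    by (rule integrable_const_bound[where B = "real N"]) (auto simp: abs_of_nonneg box_count_bounds)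
  have ind: "integrable M (indicat_real D)"
    by (intro integrable_real_indicator) (auto simp: emeasure_eq_measure)
  have "\<bar>(\<integral>\<omega>. box_count \<eta> s N \<omega> \<partial>M) - real N * p\<bar> = \<bar>\<integral>\<omega>. box_count \<eta> s N \<omega> - real N * p \<partial>M\<bar>"
    using int by (simp add: prob_space)
  also have "\<dots> \<le> (\<integral>\<omega>. \<bar>box_count \<eta> s N \<omega> - real N * p\<bar> \<partial>M)" by (rule integral_abs_bound)
  also have "\<dots> \<le> (\<integral>\<omega>. t + real N * indicat_real D \<omega> \<partial>M)"
  proof (rule integral_mono)
    fix \<omega> assume "\<omega> \<in> space M"
    have "0 \<le> real N * p" "real N * p \<le> real N" using p by (auto intro: mult_left_le)
    then have "\<bar>box_count \<eta> s N \<omega> - real N * p\<bar> \<le> real N"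
      using box_count_bounds[of \<eta> s N \<omega>] by linarith
    then show "\<bar>box_count \<eta> s N \<omega> - real N * p\<bar> \<le> t + real N * indicat_real D \<omega>"
      using \<open>\<omega> \<in> space M\<close> t by (cases "\<omega> \<in> D") (auto simp: D_def)
  qed (use int ind in auto)
  also have "\<dots> = t + real N * prob D" using ind D by (simp add: prob_space)
  finally show ?thesis by (simp add: D_def)
qed

section \<open>Uniform estimates and the union over the sector\<close>

lemma uniform_positive_lower_bound:
  fixes P :: "'c::finite \<Rightarrow> 'x \<Rightarrow> real"
  assumes "\<And>i. \<exists>\<delta>>0. \<forall>x\<in>X i. \<delta> \<le> P i x"
  shows "\<exists>\<delta>>0. \<forall>i. \<forall>x\<in>X i. \<delta> \<le> P i x"
proof -
  obtain \<delta> where \<delta>: "\<And>i. 0 < \<delta> i" "\<And>i x. x \<in> X i \<Longrightarrow> \<delta> i \<le> P i x"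
    using assms by metis
  have "0 < Min (range \<delta>)" using \<delta>(1) by (subst Min_gr_iff) auto
  moreover have "Min (range \<delta>) \<le> P i x" if "x \<in> X i" for i x
    using \<delta>(2)[OF that] by (intro order_trans[OF Min_le]) auto
  ultimately show ?thesis by blast
qed

text \<open>Here \<open>1 - p\<close> is bounded below by the probability that one colour takes a value different from the
prescribed one: the value \<open>0\<close>, or \<open>1\<close> if \<open>0\<close> is prescribed, both of which have positive
weight.\<close>

lemma box_variance_bounded_below:
  fixes b :: "'c::finite \<Rightarrow> nat \<Rightarrow> real"
  assumes ws: "\<And>i. weight_sequence (b i)" and s: "\<And>i. 0 < b i (s i)"
    and \<theta>\<^sub>1: "\<And>i. 0 < \<theta>\<^sub>1 i" and \<theta>\<^sub>2: "\<And>i. \<theta>\<^sub>2 i \<in> param_range (b i)"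
  obtains v where "0 < v"
    "\<And>\<theta>. \<forall>i. \<theta>\<^sub>1 i \<le> \<theta> i \<and> \<theta> i \<le> \<theta>\<^sub>2 i \<Longrightarrow>
       v \<le> pmf (box_law b \<theta>) s * (1 - pmf (box_law b \<theta>) s)"
proof -
  have pt: "\<exists>\<delta>>0. \<forall>i. \<forall>\<theta>\<in>{\<theta>\<^sub>1 i..\<theta>\<^sub>2 i}. \<delta> \<le> pmf (xi_law (b i) \<theta>) (k i)" if "\<And>i. 0 < b i (k i)" for k
  proof (rule uniform_positive_lower_bound)
    fix i
    show "\<exists>\<delta>>0. \<forall>\<theta>\<in>{\<theta>\<^sub>1 i..\<theta>\<^sub>2 i}. \<delta> \<le> pmf (xi_law (b i) \<theta>) (k i)"
      using weight_sequence.point_probabilities_bounded_below[OF ws \<theta>\<^sub>2 \<theta>\<^sub>1 that, of i] by (metis atLeastAtMost_iff)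
  qed
  obtain \<delta> where \<delta>: "0 < \<delta>" "\<And>i \<theta>. \<theta>\<^sub>1 i \<le> \<theta> \<Longrightarrow> \<theta> \<le> \<theta>\<^sub>2 i \<Longrightarrow> \<delta> \<le> pmf (xi_law (b i) \<theta>) (s i)"
    using pt[of s] s by auto
  define r where "r i = (if s i = 0 then 1 else 0 :: nat)" for i
  have "0 < b i (r i)" for i
    using ws[of i] by (auto simp: r_def weight_sequence_def)
  from pt[OF this] obtain \<delta>' where \<delta>': "0 < \<delta>'"
    "\<And>i \<theta>. \<theta>\<^sub>1 i \<le> \<theta> \<Longrightarrow> \<theta> \<le> \<theta>\<^sub>2 i \<Longrightarrow> \<delta>' \<le> pmf (xi_law (b i) \<theta>) (r i)"
    by auto
  have "\<delta> ^ CARD('c) * \<delta>' \<le> p * (1 - p)"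
    if th: "\<forall>i. \<theta>\<^sub>1 i \<le> \<theta> i \<and> \<theta> i \<le> \<theta>\<^sub>2 i" and p: "p = pmf (box_law b \<theta>) s" for \<theta> p
  proof (rule mult_mono)
    have "\<delta> ^ CARD('c) = (\<Prod>i\<in>(UNIV :: 'c set). \<delta>)" by simp
    also have "\<dots> \<le> p" unfolding p pmf_box_law using \<delta> th by (intro prod_mono) auto
    finally show "\<delta> ^ CARD('c) \<le> p" .
    define i where "i = (undefined :: 'c)"
    have "p = pmf (xi_law (b i) (\<theta> i)) (s i) * (\<Prod>i\<in>UNIV - {i}. pmf (xi_law (b i) (\<theta> i)) (s i))"
      unfolding p pmf_box_law by (rule prod.remove) auto
    also have "\<dots> \<le> pmf (xi_law (b i) (\<theta> i)) (s i) * 1"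
      by (intro mult_left_mono prod_le_1) (auto simp: pmf_le_1)
    finally have le: "p \<le> pmf (xi_law (b i) (\<theta> i)) (s i)" by simp
    have "pmf (xi_law (b i) (\<theta> i)) (s i) + pmf (xi_law (b i) (\<theta> i)) (r i)
        = measure_pmf.prob (xi_law (b i) (\<theta> i)) {s i, r i}"
      by (subst measure_measure_pmf_finite) (auto simp: r_def)
    also have "\<dots> \<le> 1" by simp
    finally show "\<delta>' \<le> 1 - p" using le \<delta>'(2)[of i "\<theta> i"] spec[OF th, of i] by linarith
  qed (use \<delta> \<delta>' in \<open>auto simp: p\<close>)
  then show ?thesis using that[of "\<delta> ^ CARD('c) * \<delta>'"] \<delta>(1) \<delta>'(1) by simp
qed

text \<open>The choice of \<open>l\<close> minimises the exponent after \<open>exp l\<close> has been replaced by its bound \<open>11 / 10\<close>.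
The resulting exponent is \<open>\<kappa>\<^sup>2 / (22 / 10) = (361 / 220) * (1 + 3 * K / 2)\<close>, which is at least
\<open>2 * K + 2\<close> for all \<open>K \<ge> 1\<close>; the slack there is what permits the factor \<open>19 / 10\<close> instead of
\<open>2\<close>.\<close>

lemma deviation_exponent:
  fixes K :: nat and N \<kappa> \<sigma> l t :: real
  assumes N: "1 < N" and K: "1 \<le> K" and \<sigma>: "0 < \<sigma>"
    and \<kappa>: "\<kappa> = 19 / 10 * sqrt (1 + 3 * real K / 2)"
    and l: "l = \<kappa> * sqrt (ln N / N) / (11 / 10 * \<sigma>)" and small: "exp l \<le> 11 / 10"
    and t: "t = \<kappa> * \<sigma> * sqrt (N * ln N)"
  shows "2 * exp (- l * t + N * (l\<^sup>2 * (\<sigma>\<^sup>2 * exp l) / 2)) \<le> 2 / N ^ (2 * K + 2)"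
proof -
  have lnN: "0 < ln N" using N by simp
  have \<kappa>2: "\<kappa>\<^sup>2 = 361 / 100 * (1 + 3 * real K / 2)"
    unfolding \<kappa> by (simp add: power_mult_distrib power2_eq_square)
  have lt: "l * t = \<kappa>\<^sup>2 * ln N / (11 / 10)"
  proof -
    have "sqrt (ln N / N) * sqrt (N * ln N) = ln N"
      using N lnN by (simp add: real_sqrt_mult[symmetric])
    then have "(\<kappa> * sqrt (ln N / N)) * (\<kappa> * sqrt (N * ln N)) = \<kappa>\<^sup>2 * ln N"
      by (simp add: power2_eq_square algebra_simps)
    then show ?thesis unfolding l t using \<sigma> by (simp add: field_simps)
  qed
  have l2: "N * (l\<^sup>2 * \<sigma>\<^sup>2) = \<kappa>\<^sup>2 * ln N / (11 / 10)\<^sup>2"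
    unfolding l using N lnN \<sigma> by (simp add: power_mult_distrib power_divide field_simps)
  have "N * (l\<^sup>2 * (\<sigma>\<^sup>2 * exp l) / 2) \<le> N * (l\<^sup>2 * (\<sigma>\<^sup>2 * (11 / 10)) / 2)"
    using small N by (intro mult_left_mono divide_right_mono) auto
  also have "\<dots> = N * (l\<^sup>2 * \<sigma>\<^sup>2) * (11 / 20)" by simp
  also have "\<dots> = \<kappa>\<^sup>2 * ln N / (22 / 10)" unfolding l2 by (simp add: power2_eq_square)
  finally have "- l * t + N * (l\<^sup>2 * (\<sigma>\<^sup>2 * exp l) / 2) \<le> - (\<kappa>\<^sup>2 / (22 / 10)) * ln N"
    using lt by simp
  also have "\<dots> \<le> - real (2 * K + 2) * ln N"
  proof (intro mult_right_mono)
    have "1 \<le> real K" using K by simp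
    then show "- (\<kappa>\<^sup>2 / (22 / 10)) \<le> - real (2 * K + 2)" unfolding \<kappa>2 by (simp add: field_simps)
  qed (use lnN in simp)
  finally have "exp (- l * t + N * (l\<^sup>2 * (\<sigma>\<^sup>2 * exp l) / 2)) \<le> exp (- real (2 * K + 2) * ln N)"
    by simp
  also have "\<dots> = inverse (exp (real (2 * K + 2) * ln N))" by (simp only: exp_minus[symmetric] mult_minus_left)
  also have "exp (real (2 * K + 2) * ln N) = N ^ (2 * K + 2)"
    using N by (simp only: exp_of_nat_mult exp_ln)
  finally have "exp (- l * t + N * (l\<^sup>2 * (\<sigma>\<^sup>2 * exp l) / 2)) \<le> inverse (N ^ (2 * K + 2))" .
  from mult_left_mono[OF this, of 2] show ?thesis
    by (simp only: divide_inverse zero_le_numeral simp_thms)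
qed

text \<open>The sector for a given number \<open>N\<close> of boxes. In a slice with positive lower bounds, every
\<open>n\<^sub>i\<close> grows at least linearly with \<open>N\<close>, so that largeness is a matter of \<open>N\<close> alone.\<close>

definition sector_slice :: "('c::finite \<Rightarrow> real) \<Rightarrow> ('c \<Rightarrow> real) \<Rightarrow> nat \<Rightarrow> ('c \<Rightarrow> nat) set" where
  "sector_slice \<alpha>' \<alpha>'' N = {n. \<forall>i. \<alpha>' i < real (n i) / real N \<and> real (n i) / real N < \<alpha>'' i}"

lemma sector_slice_polynomial:
  fixes \<alpha>' \<alpha>'' :: "'c::finite \<Rightarrow> real"
  obtains A where "\<And>N. 0 < N \<Longrightarrow> finite (sector_slice \<alpha>' \<alpha>'' N)"
    "\<And>N. 0 < N \<Longrightarrow> real (card (sector_slice \<alpha>' \<alpha>'' N)) \<le> real A * real N ^ CARD('c)"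
proof -
  define A where "A = nat \<lceil>Max (range \<alpha>'')\<rceil>"
  have A: "\<alpha>'' i \<le> real A" for i
    using Max_ge[of "range \<alpha>''" "\<alpha>'' i"] real_nat_ceiling_ge[of "Max (range \<alpha>'')"] by (auto simp: A_def)
  have sub: "sector_slice \<alpha>' \<alpha>'' N \<subseteq> PiE UNIV (\<lambda>_. {..<A * N})" if N: "0 < N" for N
  proof
    fix n assume n: "n \<in> sector_slice \<alpha>' \<alpha>'' N"
    have "n i < A * N" for i
    proof -
      have "real (n i) / real N < real A" using n A[of i] unfolding sector_slice_def by (blast intro: less_le_trans)
      then have "real (n i) < real (A * N)" using N by (simp add: field_simps)
      then show ?thesis by (simp only: of_nat_less_iff)
    qed
    then show "n \<in> PiE UNIV (\<lambda>_. {..<A * N})" by auto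
  qed
  have fin: "finite (PiE (UNIV :: 'c set) (\<lambda>_. {..<A * N}))" for N by (intro finite_PiE) auto
  have "real (card (sector_slice \<alpha>' \<alpha>'' N)) \<le> real (A ^ CARD('c)) * real N ^ CARD('c)" if "0 < N" for N
    using card_mono[OF fin sub[OF that]] by (simp add: card_PiE power_mult_distrib flip: of_nat_power of_nat_mult)
  then show ?thesis using that[of "A ^ CARD('c)"] finite_subset[OF sub fin] by blast
qed

lemma eventually_slices:
  assumes "\<forall>\<^sub>F N in sequentially. \<forall>n \<in> sector_slice \<alpha>' \<alpha>'' N. P n N"
  shows "\<forall>\<^sub>F x in sector_at_top \<alpha>' \<alpha>''. P (fst x) (snd x)"
proof -
  obtain m where "\<And>N. m \<le> N \<Longrightarrow> \<forall>n \<in> sector_slice \<alpha>' \<alpha>'' N. P n N"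
    using assms by (auto simp: eventually_sequentially)
  then have "\<forall>x\<in>sector \<alpha>' \<alpha>'' m. P (fst x) (snd x)"
    by (auto simp: sector_def sector_slice_def)
  then show ?thesis unfolding eventually_sector_at_top by blast
qed

text \<open>A slice has \<open>O(N powr K)\<close> elements, so the union of the exceptional events over the slice has
probability \<open>O(1 / N\<^sup>2)\<close>. Taking this union first leaves a sequence of events indexed by \<open>N\<close>
alone, and only the law of each single scheme enters.\<close>

lemma borel_cantelli_over_slices:
  assumes "prob_space M"
    and sets: "\<And>n N. {\<omega> \<in> space M. Q n N \<omega>} \<in> sets M"
    and bound: "\<forall>\<^sub>F N in sequentially. \<forall>n \<in> sector_slice \<alpha>' \<alpha>'' N.
        measure M {\<omega> \<in> space M. Q n N \<omega>} \<le> 2 / real N ^ (CARD('c) + 2)"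
  shows "AE \<omega> in M. \<forall>\<^sub>F N in sequentially. \<forall>n \<in> sector_slice \<alpha>' (\<alpha>'' :: 'c::finite \<Rightarrow> real) N. \<not> Q n N \<omega>"
proof -
  interpret prob_space M by fact
  obtain A where fin: "\<And>N. 0 < N \<Longrightarrow> finite (sector_slice \<alpha>' \<alpha>'' N)" and
    card: "\<And>N. 0 < N \<Longrightarrow> real (card (sector_slice \<alpha>' \<alpha>'' N)) \<le> real A * real N ^ CARD('c)"
    by (rule sector_slice_polynomial[of \<alpha>' \<alpha>'']) blast
  define D where "D N = (if N = 0 then {} else \<Union>n\<in>sector_slice \<alpha>' \<alpha>'' N. {\<omega> \<in> space M. Q n N \<omega>})" for N
  have D_sets: "D N \<in> sets M" for N
    using sets fin by (auto simp: D_def intro!: sets.finite_UN)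
  have le: "\<forall>\<^sub>F N in sequentially. norm (prob (D N)) \<le> 2 * real A * inverse (real N ^ 2)"
    using bound eventually_gt_at_top[of 0]
  proof eventually_elim
    case (elim N)
    have "prob (D N) \<le> (\<Sum>n\<in>sector_slice \<alpha>' \<alpha>'' N. prob {\<omega> \<in> space M. Q n N \<omega>})"
      using elim(2) by (auto simp: D_def intro!: measure_UNION_le fin sets)
    also have "\<dots> \<le> real (card (sector_slice \<alpha>' \<alpha>'' N)) * (2 / real N ^ (CARD('c) + 2))"
      using elim(1) by (intro sum_bounded_above) auto
    also have "\<dots> \<le> real A * real N ^ CARD('c) * (2 / real N ^ (CARD('c) + 2))"
      by (intro mult_right_mono card elim(2)) auto
    also have "\<dots> = 2 * real A * inverse (real N ^ 2)"
      using elim(2) by (simp add: power_add field_simps power2_eq_square)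
    finally show ?case by simp
  qed
  have "summable (\<lambda>N. prob (D N))"
    by (rule summable_comparison_test_ev[OF le]) (intro summable_mult inverse_power_summable, simp)
  then have "AE \<omega> in M. \<forall>\<^sub>F N in sequentially. \<omega> \<in> space M - D N"
    by (intro borel_cantelli_AE1 D_sets) (auto simp: emeasure_eq_measure)
  then show ?thesis
  proof (rule AE_mp, intro AE_I2 impI)
    fix \<omega> assume "\<omega> \<in> space M" "\<forall>\<^sub>F N in sequentially. \<omega> \<in> space M - D N"
    from this(2) eventually_gt_at_top[of 0]
    show "\<forall>\<^sub>F N in sequentially. \<forall>n \<in> sector_slice \<alpha>' \<alpha>'' N. \<not> Q n N \<omega>"
      by eventually_elim (auto simp: D_def)
  qed
qed

section \<open>Almost sure deviations in the sector\<close>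

locale allocation_model = prob_space M
  for M :: "'a measure" +
  fixes b :: "'c::finite \<Rightarrow> nat \<Rightarrow> real"
    and \<eta> :: "('c \<Rightarrow> nat) \<Rightarrow> nat \<Rightarrow> nat \<Rightarrow> 'a \<Rightarrow> 'c \<Rightarrow> nat"
    and \<alpha>' \<alpha>'' :: "'c \<Rightarrow> real"
    and s :: "'c \<Rightarrow> nat"
  assumes ws: "weight_sequence (b i)"
    and \<alpha>'_pos: "0 < \<alpha>' i"
    and \<alpha>''_mean: "\<alpha>'' i \<in> xi_mean (b i) ` param_range (b i)"
    and s_pos: "0 < b i (s i)"
    and scheme: "0 < N \<Longrightarrow> (\<And>i. 0 < n i) \<Longrightarrow> admissible b n N \<Longrightarrow> allocation_scheme M b n N (\<eta> n N)"
begin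

definition \<theta>_of :: "('c \<Rightarrow> nat) \<Rightarrow> nat \<Rightarrow> 'c \<Rightarrow> real" where
  "\<theta>_of n N i = xi_mean_inv (b i) (real (n i) / real N)"

lemma parameters_in_compact:
  obtains \<theta>\<^sub>1 \<theta>\<^sub>2 where "\<And>i. 0 < \<theta>\<^sub>1 i" "\<And>i. \<theta>\<^sub>2 i \<in> param_range (b i)"
    "\<And>n N i. n \<in> sector_slice \<alpha>' \<alpha>'' N \<Longrightarrow>
       xi_mean (b i) (\<theta>_of n N i) = real (n i) / real N
       \<and> \<theta>\<^sub>1 i \<le> \<theta>_of n N i \<and> \<theta>_of n N i \<le> \<theta>\<^sub>2 i"
proof -
  have "\<exists>\<theta>\<^sub>1 \<theta>\<^sub>2. 0 < \<theta>\<^sub>1 \<and> \<theta>\<^sub>2 \<in> param_range (b i) \<and> (\<forall>\<alpha>. \<alpha>' i < \<alpha> \<longrightarrow> \<alpha> < \<alpha>'' i \<longrightarrow>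
      xi_mean (b i) (xi_mean_inv (b i) \<alpha>) = \<alpha>
       \<and> \<theta>\<^sub>1 \<le> xi_mean_inv (b i) \<alpha> \<and> xi_mean_inv (b i) \<alpha> \<le> \<theta>\<^sub>2)" for i
    using weight_sequence.mean_inverse_in_compact[OF ws \<alpha>'_pos \<alpha>''_mean, of i] by metis
  then obtain \<theta>\<^sub>1 \<theta>\<^sub>2 where "\<And>i. 0 < \<theta>\<^sub>1 i" "\<And>i. \<theta>\<^sub>2 i \<in> param_range (b i)"
    "\<And>i \<alpha>. \<alpha>' i < \<alpha> \<Longrightarrow> \<alpha> < \<alpha>'' i \<Longrightarrow> xi_mean (b i) (xi_mean_inv (b i) \<alpha>) = \<alpha>
       \<and> \<theta>\<^sub>1 i \<le> xi_mean_inv (b i) \<alpha> \<and> xi_mean_inv (b i) \<alpha> \<le> \<theta>\<^sub>2 i"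
    by metis
  then show ?thesis using that[of \<theta>\<^sub>1 \<theta>\<^sub>2] by (auto simp: sector_slice_def \<theta>_of_def)
qed

lemma p_box_eq:
  assumes "\<And>i. \<theta>_of n N i \<in> param_range (b i)"
  shows "p_box b s n N = pmf (box_law b (\<theta>_of n N)) s"
proof -
  have "pmf (xi_law (b i) (\<theta>_of n N i)) (s i)
      = b i (s i) * \<theta>_of n N i ^ s i / (fact (s i) * B_series (b i) (\<theta>_of n N i))" for i
    by (rule weight_sequence.pmf_xi[OF ws assms])
  then show ?thesis
    by (simp only: p_box_def pmf_box_law Let_def \<theta>_of_def)
qed

definition conditioning_prob :: "('c \<Rightarrow> nat) \<Rightarrow> nat \<Rightarrow> real" where
  "conditioning_prob n N =
     (\<Prod>i\<in>UNIV.
        measure_pmf.prob (xi_copies (b i) (\<theta>_of n N i) N) {x. (\<Sum>j=1..N. x j) = n i})"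

text \<open>The local lower bound serves twice: it bounds the cost of conditioning, and it shows that the
conditioning event has positive probability, so that the scheme is defined at all for every
\<open>n\<close> in the slice.\<close>

lemma slice_facts:
  obtains v where "0 < v"
    "\<forall>\<^sub>F N in sequentially. \<forall>n \<in> sector_slice \<alpha>' \<alpha>'' N.
        v \<le> p_box b s n N * (1 - p_box b s n N)
      \<and> allocation_scheme M b n N (\<eta> n N)
      \<and> (\<forall>i. \<theta>_of n N i \<in> param_range (b i))
      \<and> 1 / real N ^ CARD('c) \<le> conditioning_prob n N"
proof -
  obtain \<theta>\<^sub>1 \<theta>\<^sub>2 where \<theta>\<^sub>1: "\<And>i. 0 < \<theta>\<^sub>1 i" and \<theta>\<^sub>2: "\<And>i. \<theta>\<^sub>2 i \<in> param_range (b i)"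
    and \<theta>: "\<And>n N i. n \<in> sector_slice \<alpha>' \<alpha>'' N \<Longrightarrow>
       xi_mean (b i) (\<theta>_of n N i) = real (n i) / real N
       \<and> \<theta>\<^sub>1 i \<le> \<theta>_of n N i \<and> \<theta>_of n N i \<le> \<theta>\<^sub>2 i"
    by (rule parameters_in_compact) blast
  obtain v where v: "0 < v"
    "\<And>\<theta>. \<forall>i. \<theta>\<^sub>1 i \<le> \<theta> i \<and> \<theta> i \<le> \<theta>\<^sub>2 i \<Longrightarrow>
       v \<le> pmf (box_law b \<theta>) s * (1 - pmf (box_law b \<theta>) s)"
    by (rule box_variance_bounded_below[OF ws s_pos \<theta>\<^sub>1 \<theta>\<^sub>2], rule that)
  have "\<forall>\<^sub>F N in sequentially. \<forall>i. \<forall>\<theta> n. \<theta>\<^sub>1 i \<le> \<theta> \<longrightarrow> \<theta> \<le> \<theta>\<^sub>2 i \<longrightarrow> real N * xi_mean (b i) \<theta> = real n \<longrightarrow>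
           1 / real N \<le> measure_pmf.prob (xi_copies (b i) \<theta> N) {x. (\<Sum>j=1..N. x j) = n}"
    by (intro eventually_all_finite weight_sequence.local_lower_bound[OF ws \<theta>\<^sub>2 \<theta>\<^sub>1])
  then have "\<forall>\<^sub>F N in sequentially. \<forall>n \<in> sector_slice \<alpha>' \<alpha>'' N.
        v \<le> p_box b s n N * (1 - p_box b s n N)
      \<and> allocation_scheme M b n N (\<eta> n N)
      \<and> (\<forall>i. \<theta>_of n N i \<in> param_range (b i))
      \<and> 1 / real N ^ CARD('c) \<le> conditioning_prob n N"
    using eventually_gt_at_top[of 0]
  proof eventually_elim
    case (elim N)
    show ?case
    proof
      fix n assume n: "n \<in> sector_slice \<alpha>' \<alpha>'' N"
      have rng: "\<theta>_of n N i \<in> param_range (b i)" for i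
        using weight_sequence.param_range_downward[OF ws \<theta>\<^sub>2] \<theta>[OF n, of i] \<theta>\<^sub>1[of i] by auto
      have lb: "1 / real N \<le> measure_pmf.prob (xi_copies (b i) (\<theta>_of n N i) N) {x. (\<Sum>j=1..N. x j) = n i}" for i
        using elim \<theta>[OF n, of i] by auto
      have "n i > 0" for i
        using n \<alpha>'_pos[of i] by (auto simp: sector_slice_def intro!: gr0I dest!: spec[of _ i])
      moreover have "admissible b n N"
        unfolding admissible_def
      proof
        fix i
        have "0 < 1 / real N" using elim by simp
        then show "\<exists>\<theta>\<in>param_range (b i). 0 < measure_pmf.prob (xi_copies (b i) \<theta> N) {x. (\<Sum>j=1..N. x j) = n i}"
          using lb[of i] rng[of i] by (meson less_le_trans)
      qed
      ultimately have "allocation_scheme M b n N (\<eta> n N)" using scheme elim by blast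
      moreover have "v \<le> p_box b s n N * (1 - p_box b s n N)"
        using v(2)[of "\<theta>_of n N"] \<theta>[OF n] by (simp add: p_box_eq[OF rng])
      moreover have "(\<Prod>i\<in>(UNIV :: 'c set). 1 / real N)
          \<le> conditioning_prob n N"
        unfolding conditioning_prob_def using lb by (intro prod_mono) auto
      ultimately show "v \<le> p_box b s n N * (1 - p_box b s n N)
      \<and> allocation_scheme M b n N (\<eta> n N)
      \<and> (\<forall>i. \<theta>_of n N i \<in> param_range (b i))
      \<and> 1 / real N ^ CARD('c) \<le> conditioning_prob n N"
        using rng by (simp add: power_divide)
    qed
  qed
  then show ?thesis using that v(1) by blast
qed

text \<open>Slightly less than half of the constant in the theorem: the deviations of \<open>\<mu>\<close> and of its
expectation from \<open>N p\<close> contribute one \<open>\<kappa>\<close> each, and the reserve absorbs a bounded error.\<close>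

definition \<kappa> :: real where "\<kappa> = 19 / 10 * sqrt (1 + 3 * real CARD('c) / 2)"

definition threshold :: "('c \<Rightarrow> nat) \<Rightarrow> nat \<Rightarrow> real" where
  "threshold n N = \<kappa> * sigma_box b s n N * sqrt (real N * ln (real N))"

definition \<mu> :: "('c \<Rightarrow> nat) \<Rightarrow> nat \<Rightarrow> 'a \<Rightarrow> real" where
  "\<mu> n N = box_count (\<eta> n N) s N"

lemma \<kappa>_pos: "0 < \<kappa>" by (simp add: \<kappa>_def add_pos_nonneg)

text \<open>The tail of order \<open>N powr - (2 K + 2)\<close> in the independent model, divided by the probability
\<open>\<ge> N powr - K\<close> of the conditioning event.\<close>

lemma deviation_probability:
  "\<forall>\<^sub>F N in sequentially. \<forall>n \<in> sector_slice \<alpha>' \<alpha>'' N.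
     \<mu> n N \<in> borel_measurable M
     \<and> measure M {\<omega> \<in> space M. threshold n N \<le> \<bar>\<mu> n N \<omega> - real N * p_box b s n N\<bar>}
         \<le> 2 / real N ^ (CARD('c) + 2)"
proof -
  obtain v where v: "0 < v" and facts:
    "\<forall>\<^sub>F N in sequentially. \<forall>n \<in> sector_slice \<alpha>' \<alpha>'' N.
        v \<le> p_box b s n N * (1 - p_box b s n N)
      \<and> allocation_scheme M b n N (\<eta> n N)
      \<and> (\<forall>i. \<theta>_of n N i \<in> param_range (b i))
      \<and> 1 / real N ^ CARD('c) \<le> conditioning_prob n N"
    by (rule slice_facts)
  have "\<forall>\<^sub>F x in at_top. exp (\<kappa> * sqrt (ln x / x) / (11 / 10 * sqrt v)) \<le> 11 / 10"
    using v \<kappa>_pos by real_asymp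
  from facts eventually_compose_filterlim[OF this filterlim_real_sequentially] eventually_gt_at_top[of 1]
  show ?thesis
  proof eventually_elim
    case (elim N)
    have N: "1 < real N" using elim by simp
    show ?case
    proof
      fix n assume n: "n \<in> sector_slice \<alpha>' \<alpha>'' N"
      define p where "p = p_box b s n N"
      define \<sigma> where "\<sigma> = sigma_box b s n N"
      define z where "z = conditioning_prob n N"
      define l where "l = \<kappa> * sqrt (ln N / N) / (11 / 10 * \<sigma>)"
      have var: "v \<le> p * (1 - p)" and sch: "allocation_scheme M b n N (\<eta> n N)"
        and rng: "\<And>i. \<theta>_of n N i \<in> param_range (b i)" and zN: "1 / real N ^ CARD('c) \<le> z"
        using elim(1) n by (auto simp: p_def z_def)
      have \<sigma>: "sqrt v \<le> \<sigma>" "0 < \<sigma>" "\<sigma>\<^sup>2 = p * (1 - p)"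
        using var v by (auto simp: \<sigma>_def sigma_box_def p_def)
      have l: "0 < l" using \<kappa>_pos N \<sigma> by (simp add: l_def)
      have "l \<le> \<kappa> * sqrt (ln N / N) / (11 / 10 * sqrt v)"
        unfolding l_def using \<sigma> v \<kappa>_pos N by (intro divide_left_mono) auto
      then have small: "exp l \<le> 11 / 10" using elim(2) by (meson exp_le_cancel_iff order_trans)
      have z: "0 < z" using zN N by (meson less_le_trans zero_less_divide_1_iff zero_less_power less_trans zero_less_one)
      have p: "p = pmf (box_law b (\<theta>_of n N)) s" unfolding p_def by (rule p_box_eq[OF rng])
      define E where "E = 2 * exp (- l * threshold n N + real N * (l\<^sup>2 * (p * (1 - p) * exp l) / 2))"
      have "prob {\<omega> \<in> space M. threshold n N \<le> \<bar>\<mu> n N \<omega> - real N * p\<bar>} \<le> E / z"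
        unfolding \<mu>_def E_def by (rule box_count_tail[OF prob_space_axioms sch ws rng _ z l p])
           (simp add: z_def conditioning_prob_def)
      also have "\<dots> \<le> 2 / real N ^ (2 * CARD('c) + 2) / (1 / real N ^ CARD('c))"
      proof (rule frac_le)
        show "E \<le> 2 / real N ^ (2 * CARD('c) + 2)"
          unfolding E_def \<sigma>(3)[symmetric]
          by (rule deviation_exponent[OF N _ \<sigma>(2) \<kappa>_def l_def small])
             (simp_all add: threshold_def \<sigma>_def Suc_leI)
      qed (use zN N in auto)
      also have "\<dots> = 2 / real N ^ (CARD('c) + 2)"
      proof -
        have "real N ^ (2 * CARD('c) + 2) = real N ^ CARD('c) * real N ^ (CARD('c) + 2)"
          by (simp add: power_add[symmetric] mult_2)
        then show ?thesis using N by simp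
      qed
      finally show "\<mu> n N \<in> borel_measurable M
          \<and> prob {\<omega> \<in> space M. threshold n N \<le> \<bar>\<mu> n N \<omega> - real N * p_box b s n N\<bar>}
              \<le> 2 / real N ^ (CARD('c) + 2)"
        using box_count_measurable[OF sch] by (simp add: p_def \<mu>_def)
    qed
  qed
qed

text \<open>This is the deterministic part of the argument. The bounded error is at most \<open>2\<close>, because
\<open>N\<close> times the probability of the deviation event is; eventually it is below a small multiple of
\<open>\<sigma> sqrt (N ln N)\<close>, which tends to infinity uniformly.\<close>

lemma ratio_bound:
  "\<forall>\<^sub>F N in sequentially. \<forall>n \<in> sector_slice \<alpha>' \<alpha>'' N. \<forall>\<omega>.
     \<bar>\<mu> n N \<omega> - real N * p_box b s n N\<bar> < threshold n N \<longrightarrow>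
     \<bar>\<mu> n N \<omega> - expectation (\<mu> n N)\<bar> / (sqrt (real N * ln (real N)) * sigma_box b s n N)
       \<le> 4 * sqrt (1 + 3 * real CARD('c) / 2)"
proof -
  obtain v where v: "0 < v" and facts:
    "\<forall>\<^sub>F N in sequentially. \<forall>n \<in> sector_slice \<alpha>' \<alpha>'' N.
        v \<le> p_box b s n N * (1 - p_box b s n N)
      \<and> allocation_scheme M b n N (\<eta> n N)
      \<and> (\<forall>i. \<theta>_of n N i \<in> param_range (b i))
      \<and> 1 / real N ^ CARD('c) \<le> conditioning_prob n N"
    by (rule slice_facts)
  have "\<forall>\<^sub>F x in at_top. 2 \<le> 2 / 19 * \<kappa> * (sqrt v * sqrt (x * ln x))"
    using v \<kappa>_pos by real_asymp
  from facts deviation_probability eventually_compose_filterlim[OF this filterlim_real_sequentially]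
    eventually_gt_at_top[of 1]
  show ?thesis
  proof eventually_elim
    case (elim N)
    have N: "1 < real N" using elim by simp
    show ?case
    proof (intro ballI allI impI)
      fix n \<omega> assume n: "n \<in> sector_slice \<alpha>' \<alpha>'' N"
      define p where "p = p_box b s n N"
      define R where "R = sqrt (real N * ln (real N)) * sigma_box b s n N"
      assume dev: "\<bar>\<mu> n N \<omega> - real N * p_box b s n N\<bar> < threshold n N"
      have var: "v \<le> p * (1 - p)" and sch: "allocation_scheme M b n N (\<eta> n N)"
        and rng: "\<And>i. \<theta>_of n N i \<in> param_range (b i)"
        using elim(1) n by (auto simp: p_def)
      have \<sigma>: "sqrt v \<le> sigma_box b s n N" "0 < sigma_box b s n N"
        using var v by (auto simp: sigma_box_def p_def)
      have R: "0 < R" using N \<sigma> by (simp add: R_def)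
      have thr: "threshold n N = \<kappa> * R" by (simp add: threshold_def R_def)
      have p01: "0 \<le> p" "p \<le> 1" unfolding p_def p_box_eq[OF rng] by (auto simp: pmf_le_1)
      have "\<bar>expectation (\<mu> n N) - real N * p\<bar> \<le> threshold n N
          + real N * prob {\<omega> \<in> space M. threshold n N \<le> \<bar>\<mu> n N \<omega> - real N * p\<bar>}"
        unfolding \<mu>_def
        by (rule box_count_mean_deviation[OF prob_space_axioms sch p01]) (use thr \<kappa>_pos R in simp)
      also have "\<dots> \<le> threshold n N + real N * (2 / real N ^ (CARD('c) + 2))"
        using elim(2) n by (intro add_left_mono mult_left_mono) (auto simp: p_def)
      also have "real N * (2 / real N ^ (CARD('c) + 2)) \<le> 2"
      proof -
        have "real N * (2 / real N ^ (CARD('c) + 2)) = 2 * (1 / real N ^ (CARD('c) + 1))"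
          using N by (simp add: power_add field_simps power2_eq_square)
        also have "\<dots> \<le> 2 * 1"
          using one_le_power[of "real N" "CARD('c) + 1"] N by (intro mult_left_mono) auto
        finally show ?thesis by simp
      qed
      also have "2 \<le> 2 / 19 * \<kappa> * (sqrt v * sqrt (real N * ln (real N)))" by (rule elim(3))
      also have "\<dots> \<le> 2 / 19 * \<kappa> * R"
      proof (rule mult_left_mono)
        show "sqrt v * sqrt (real N * ln (real N)) \<le> R"
          unfolding R_def mult.commute[of "sqrt v"] using \<sigma> N by (intro mult_left_mono) auto
      qed (use \<kappa>_pos in simp)
      finally have "\<bar>expectation (\<mu> n N) - real N * p\<bar> \<le> \<kappa> * R + 2 / 19 * \<kappa> * R"
        unfolding thr by simp
      moreover have "\<bar>\<mu> n N \<omega> - real N * p\<bar> \<le> \<kappa> * R"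
        using dev by (simp add: thr p_def)
      moreover have "\<bar>\<mu> n N \<omega> - expectation (\<mu> n N)\<bar>
          \<le> \<bar>\<mu> n N \<omega> - real N * p\<bar> + \<bar>expectation (\<mu> n N) - real N * p\<bar>"
        by linarith
      ultimately have "\<bar>\<mu> n N \<omega> - expectation (\<mu> n N)\<bar> \<le> (40 / 19 * \<kappa>) * R"
        by linarith
      then show "\<bar>\<mu> n N \<omega> - expectation (\<mu> n N)\<bar> / (sqrt (real N * ln (real N)) * sigma_box b s n N)
          \<le> 4 * sqrt (1 + 3 * real CARD('c) / 2)"
        using R by (simp add: R_def[symmetric] \<kappa>_def pos_divide_le_eq)
    qed
  qed
qed

lemma almost_surely_small_deviations:
  "AE \<omega> in M. \<forall>\<^sub>F N in sequentially. \<forall>n \<in> sector_slice \<alpha>' \<alpha>'' N.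
     \<bar>\<mu> n N \<omega> - real N * p_box b s n N\<bar> < threshold n N"
proof -
  \<comment> \<open>Measurability is made part of the event, since it is only known for large \<open>N\<close>, where the scheme is admissible.\<close>
  define Q where "Q n N \<omega> \<longleftrightarrow> \<mu> n N \<in> borel_measurable M
      \<and> threshold n N \<le> \<bar>\<mu> n N \<omega> - real N * p_box b s n N\<bar>" for n N \<omega>
  have "AE \<omega> in M. \<forall>\<^sub>F N in sequentially. \<forall>n \<in> sector_slice \<alpha>' \<alpha>'' N. \<not> Q n N \<omega>"
  proof (rule borel_cantelli_over_slices[OF prob_space_axioms])
    show "{\<omega> \<in> space M. Q n N \<omega>} \<in> events" for n N
      unfolding Q_def by (cases "\<mu> n N \<in> borel_measurable M") simp_all
    show "\<forall>\<^sub>F N in sequentially. \<forall>n\<in>sector_slice \<alpha>' \<alpha>'' N.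
        prob {\<omega> \<in> space M. Q n N \<omega>} \<le> 2 / real N ^ (CARD('c) + 2)"
      using deviation_probability by eventually_elim (auto simp: Q_def)
  qed
  then show ?thesis
  proof (rule AE_mp, intro AE_I2 impI)
    fix \<omega> assume "\<forall>\<^sub>F N in sequentially. \<forall>n \<in> sector_slice \<alpha>' \<alpha>'' N. \<not> Q n N \<omega>"
    with deviation_probability
    show "\<forall>\<^sub>F N in sequentially. \<forall>n \<in> sector_slice \<alpha>' \<alpha>'' N.
        \<bar>\<mu> n N \<omega> - real N * p_box b s n N\<bar> < threshold n N"
      by eventually_elim (auto simp: Q_def not_le)
  qed
qed

end

theorem theorem2p2:
  fixes M :: "'a measure"
    and b :: "'c::finite \<Rightarrow> nat \<Rightarrow> real"
    and \<eta> :: "('c \<Rightarrow> nat) \<Rightarrow> nat \<Rightarrow> nat \<Rightarrow> 'a \<Rightarrow> 'c \<Rightarrow> nat"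
    and \<alpha>' \<alpha>'' :: "'c \<Rightarrow> real"
    and s :: "'c \<Rightarrow> nat"
  assumes "prob_space M"
    and "\<And>i k. 0 \<le> b i k"
    and "\<And>i. 0 < b i 0"
    and "\<And>i. 0 < b i 1"
    and "\<And>i. 0 < B_radius (b i)"
    and "\<And>i. 0 < \<alpha>' i"
    and "\<And>i. \<alpha>' i < \<alpha>'' i"
    and "\<And>i. \<alpha>'' i \<in> xi_mean (b i) ` param_range (b i)"
    and "\<And>i. 0 < b i (s i)"
    and "\<And>n N. 0 < N \<Longrightarrow> (\<And>i. 0 < n i) \<Longrightarrow> admissible b n N
           \<Longrightarrow> allocation_scheme M b n N (\<eta> n N)"
  shows "AE \<omega> in M.
    Limsup (sector_at_top \<alpha>' \<alpha>'')
      (\<lambda>(n, N). ereal (\<bar>box_count (\<eta> n N) s N \<omega> - (\<integral>\<omega>'. box_count (\<eta> n N) s N \<omega>' \<partial>M)\<bar>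
         / (sqrt (real N * ln (real N)) * sigma_box b s n N)))
    \<le> ereal (4 * sqrt (1 + 3 * real CARD('c) / 2))"
proof -
  interpret prob_space M by fact
  interpret allocation_model M b \<eta> \<alpha>' \<alpha>'' s
    by unfold_locales (use assms in \<open>auto simp: weight_sequence_def\<close>)
  show ?thesis
    using almost_surely_small_deviations
  proof (rule AE_mp, intro AE_I2 impI)
    fix \<omega> assume "\<forall>\<^sub>F N in sequentially. \<forall>n \<in> sector_slice \<alpha>' \<alpha>'' N.
        \<bar>\<mu> n N \<omega> - real N * p_box b s n N\<bar> < threshold n N"
    with ratio_bound have "\<forall>\<^sub>F N in sequentially. \<forall>n \<in> sector_slice \<alpha>' \<alpha>'' N.
       \<bar>\<mu> n N \<omega> - expectation (\<mu> n N)\<bar> / (sqrt (real N * ln (real N)) * sigma_box b s n N)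
       \<le> 4 * sqrt (1 + 3 * real CARD('c) / 2)"
      by eventually_elim blast
    from eventually_slices[OF this]
    show "Limsup (sector_at_top \<alpha>' \<alpha>'')
      (\<lambda>(n, N). ereal (\<bar>box_count (\<eta> n N) s N \<omega> - (\<integral>\<omega>'. box_count (\<eta> n N) s N \<omega>' \<partial>M)\<bar>
         / (sqrt (real N * ln (real N)) * sigma_box b s n N)))
      \<le> ereal (4 * sqrt (1 + 3 * real CARD('c) / 2))"
      by (intro Limsup_bounded) (simp add: case_prod_unfold \<mu>_def)
  qed
qed

end
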